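(* Let $\mathcal{L}$ be a countable first-order language and let $\mathcal{N}\in\mathrm{Str}(\mathcal{L},\mathbb{N})$ be a countable $\mathcal{L}$-structure with domain $\mathbb{N}$. Then $\mathcal{N}$ is quasi-random if and only if $\mathcal{N}$ is not highly algebraic.
   Context: A countable language $\mathcal{L}$ is a countable set of relation and function symbols, each with a finite arity. $\mathrm{Str}(\mathcal{L},\mathbb{N})$ is the set of all $\mathcal{L}$-structures with domain $\mathbb{N}$, identified with the Polish space $\prod_{R}2^{\mathbb{N}^{n(R)}}\times\prod_{f}\mathbb{N}^{\mathbb{N}^{n(f)}}$ (products over relation symbols $R$ and function symbols $f$ of $\mathcal{L}$, with arities $n(R),n(f)$). The logic action of $\mathrm{Sym}(\mathbb{N})$ (the Polish group of all permutations of $\mathbb{N}$, pointwise convergence topology) on $\mathrm{Str}(\mathcal{L},\mathbb{N})$ is $g_*\mathcal{M}\models R(a_0,\dots,a_{n-1})\iff \mathcal{M}\models R(g^{-1}a_0,\dots,g^{-1}a_{n-1})$ and $g_*\mathcal{M}\models b=f(a_0,\dots,a_{n-1})\iff \mathcal{M}\models g^{-1}b=f(g^{-1}a_0,\dots,g^{-1}a_{n-1})$. The isomorphism class $[\mathcal{N}]_{\mathrm{iso}}$ is the set of $\mathcal{M}\in\mathrm{Str}(\mathcal{L},\mathbb{N})$ isomorphic to $\mathcal{N}$. A Borel probability measure $\mu$ is $\mathrm{Sym}(\mathbb{N})$-quasi-invariant if for every Borel $B$ and every $g$, $\mu(B)=0\iff\mu(g\cdot B)=0$. $\mathcal{N}$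 is quasi-random if there is a $\mathrm{Sym}(\mathbb{N})$-quasi-invariant Borel probability measure $\mu$ on $\mathrm{Str}(\mathcal{L},\mathbb{N})$ with $\mu([\mathcal{N}]_{\mathrm{iso}})=1$. For a finite tuple $\bar a=(a_0,\dots,a_{n-1})$ from the domain, $\mathrm{Aut}(\mathcal{N})_{\bar a}$ is the pointwise stabilizer of $a_0,\dots,a_{n-1}$ in $\mathrm{Aut}(\mathcal{N})$, and $\mathrm{acl}(\bar a,\mathcal{N})$ is the set of elements $b$ of the domain whose orbit $\mathrm{Aut}(\mathcal{N})_{\bar a}\cdot b$ is finite. $\mathcal{N}$ is highly algebraic if for every finite $F\subseteq\mathrm{dom}(\mathcal{N})$ there is a tuple $\bar a=(a_0,\dots,a_{n-1})$ in $\mathrm{dom}(\mathcal{N})$ with $\mathrm{acl}(\bar a,\mathcal{N})\not\subseteq F\cup\{a_0,\dots,a_{n-1}\}$. *)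

theory Defs
  imports "HOL-Analysis.Analysis" "HOL-Probability.Probability_Measure"
begin

record ('r, 'f) language =
  rel_syms :: "'r set"
  fun_syms :: "'f set"
  rel_arity :: "'r \<Rightarrow> nat"
  fun_arity :: "'f \<Rightarrow> nat"

definition countable_language :: "('r, 'f) language \<Rightarrow> bool" where
  "countable_language L \<longleftrightarrow> countable (rel_syms L) \<and> countable (fun_syms L)"

definition tuples :: "nat \<Rightarrow> nat list set" where
  "tuples n = {as. length as = n}"

text \<open>A structure with domain the natural numbers is a pair of interpretations: one of the
  relation symbols and one of the function symbols. Interpretations are extensional, that is,
  \<^const>\<open>undefined\<close> outside the symbols of the language and on lists of the wrong length, so that
  each structure has exactly one representation.\<close>

type_synonym ('r, 'f) struct = "('r \<Rightarrow> nat list \<Rightarrow> bool) \<times> ('f \<Rightarrow> nat list \<Rightarrow> nat)"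

definition Str :: "('r, 'f) language \<Rightarrow> ('r, 'f) struct set" where
  "Str L = (\<Pi>\<^sub>E R\<in>rel_syms L. \<Pi>\<^sub>E as\<in>tuples (rel_arity L R). UNIV) \<times>
           (\<Pi>\<^sub>E f\<in>fun_syms L. \<Pi>\<^sub>E as\<in>tuples (fun_arity L f). UNIV)"

definition Str_topology :: "('r, 'f) language \<Rightarrow> ('r, 'f) struct topology" where
  "Str_topology L = prod_topology
     (product_topology (\<lambda>R. product_topology (\<lambda>as. discrete_topology (UNIV :: bool set))
        (tuples (rel_arity L R))) (rel_syms L))
     (product_topology (\<lambda>f. product_topology (\<lambda>as. discrete_topology (UNIV :: nat set))
        (tuples (fun_arity L f))) (fun_syms L))"

lemma topspace_Str_topology: "topspace (Str_topology L) = Str L"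
  by (simp add: Str_topology_def Str_def)

text \<open>Only the \<open>\<sigma>\<close>-algebra of this measure matters.\<close>

definition Str_borel :: "('r, 'f) language \<Rightarrow> ('r, 'f) struct measure" where
  "Str_borel L = sigma (Str L) {U. openin (Str_topology L) U}"

lemma space_Str_borel: "space (Str_borel L) = Str L"
  by (simp add: Str_borel_def space_measure_of_conv)

lemma sets_Str_borel: "sets (Str_borel L) = sigma_sets (Str L) {U. openin (Str_topology L) U}"
  unfolding Str_borel_def
  by (rule sets_measure_of) (use openin_subset in \<open>fastforce simp: topspace_Str_topology\<close>)

definition logic_action ::
  "('r, 'f) language \<Rightarrow> (nat \<Rightarrow> nat) \<Rightarrow> ('r, 'f) struct \<Rightarrow> ('r, 'f) struct" where
  "logic_action L g M =
     ((\<lambda>R\<in>rel_syms L. \<lambda>as\<in>tuples (rel_arity L R). fst M R (map (inv g) as)),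
      (\<lambda>f\<in>fun_syms L. \<lambda>as\<in>tuples (fun_arity L f). g (snd M f (map (inv g) as))))"

lemma logic_action_in_Str: "logic_action L g M \<in> Str L"
  by (auto simp: logic_action_def Str_def)

lemma logic_action_rel:
  assumes "R \<in> rel_syms L" "length as = rel_arity L R"
  shows "fst (logic_action L g M) R as \<longleftrightarrow> fst M R (map (inv g) as)"
  using assms by (simp add: logic_action_def tuples_def)

lemma logic_action_fun:
  assumes "bij g" "f \<in> fun_syms L" "length as = fun_arity L f"
  shows "b = snd (logic_action L g M) f as \<longleftrightarrow> inv g b = snd M f (map (inv g) as)"
  using assms bij_inv_eq_iff[OF assms(1)] by (simp add: logic_action_def tuples_def) metis

definition isomorphism ::
  "('r, 'f) language \<Rightarrow> ('r, 'f) struct \<Rightarrow> ('r, 'f) struct \<Rightarrow> (nat \<Rightarrow> nat) \<Rightarrow> bool" where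
  "isomorphism L M N h \<longleftrightarrow> bij h \<and>
     (\<forall>R\<in>rel_syms L. \<forall>as\<in>tuples (rel_arity L R). fst M R as \<longleftrightarrow> fst N R (map h as)) \<and>
     (\<forall>f\<in>fun_syms L. \<forall>as\<in>tuples (fun_arity L f). h (snd M f as) = snd N f (map h as))"

definition iso_class :: "('r, 'f) language \<Rightarrow> ('r, 'f) struct \<Rightarrow> ('r, 'f) struct set" where
  "iso_class L N = {M \<in> Str L. \<exists>h. isomorphism L M N h}"

definition borel_prob_measure :: "('r, 'f) language \<Rightarrow> ('r, 'f) struct measure \<Rightarrow> bool" where
  "borel_prob_measure L \<mu> \<longleftrightarrow> prob_space \<mu> \<and> sets \<mu> = sets (Str_borel L)"

definition quasi_invariant :: "('r, 'f) language \<Rightarrow> ('r, 'f) struct measure \<Rightarrow> bool" where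
  "quasi_invariant L \<mu> \<longleftrightarrow>
     (\<forall>B\<in>sets (Str_borel L). \<forall>g. bij g \<longrightarrow>
        (emeasure \<mu> B = 0 \<longleftrightarrow> emeasure \<mu> (logic_action L g ` B) = 0))"

definition quasi_random :: "('r, 'f) language \<Rightarrow> ('r, 'f) struct \<Rightarrow> bool" where
  "quasi_random L N \<longleftrightarrow>
     (\<exists>\<mu>. borel_prob_measure L \<mu> \<and> quasi_invariant L \<mu> \<and> emeasure \<mu> (iso_class L N) = 1)"

definition Aut :: "('r, 'f) language \<Rightarrow> ('r, 'f) struct \<Rightarrow> (nat \<Rightarrow> nat) set" where
  "Aut L N = {g. isomorphism L N N g}"

definition Aut_stabilizer ::
  "('r, 'f) language \<Rightarrow> ('r, 'f) struct \<Rightarrow> nat list \<Rightarrow> (nat \<Rightarrow> nat) set" where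
  "Aut_stabilizer L N as = {g \<in> Aut L N. \<forall>a\<in>set as. g a = a}"

definition acl :: "('r, 'f) language \<Rightarrow> nat list \<Rightarrow> ('r, 'f) struct \<Rightarrow> nat set" where
  "acl L as N = {b. finite {g b | g. g \<in> Aut_stabilizer L N as}}"

definition highly_algebraic :: "('r, 'f) language \<Rightarrow> ('r, 'f) struct \<Rightarrow> bool" where
  "highly_algebraic L N \<longleftrightarrow>
     (\<forall>F. finite F \<longrightarrow> (\<exists>as. \<not> acl L as N \<subseteq> F \<union> set as))"

end

theory Submission
  imports Defs "HOL-Probability.Probability"
begin

text \<open>Suppose that the structure \<open>N\<close> is highly algebraic and that \<open>\<mu>\<close> lives on its isomorphism class.
  For every finite set \<open>D\<close>, almost every copy \<open>M\<close> of \<open>N\<close> has a tuple \<open>xs\<close> with a point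
  \<open>y \<notin> D \<union> set xs\<close> algebraic over it. A permutation prescribed on \<open>D\<close> may still send \<open>y\<close> to a
  random far away point, and as only boundedly many points can play the role of \<open>y\<close> over the image of \<open>xs\<close>,
  this maps a set of measure close to 1 to a set of measure close to 0. Iterating this gives in the limit a
  single permutation which maps a set of positive measure to a null set.

  Conversely, suppose that for some finite \<open>F\<close> all orbits of pointwise stabilizers outside \<open>F\<close> and the
  stabilized tuple are infinite. Exhaust the complement of \<open>F\<close> by finite sets \<open>A n\<close>, together with injections
  \<open>d n\<close> of \<open>A n\<close> into the complement of \<open>A n\<close> such that every choice between staying put and following
  \<open>d n\<close> is induced on \<open>A n\<close> by an automorphism. Let infinitely many independent particles start at random
  points and follow \<open>d n\<close> at time \<open>n\<close> according to fair coins, apart from a few particles which occupy \<open>F\<close>.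
  The coins separate any two particles, and from then on finite tuples of particles move by automorphisms of
  \<open>N\<close>. Hence their isomorphism types converge and define a structure on the set of particles, which
  back-and-forth shows to be a copy of \<open>N\<close>. The particles being exchangeable up to the choice of the
  ones on \<open>F\<close>, the law of this structure is quasi-invariant.\<close>

section \<open>Borel structure of the space of structures\<close>

lemma countable_tuples: "countable (tuples n)"
  by (rule countableI_type)

text \<open>A basic open box restricts only finitely many coordinates; freezing these at their
  values in \<open>x\<close> keeps a point inside the box.\<close>

lemma product_discrete_cylinder:
  assumes "openin (product_topology (\<lambda>a. discrete_topology UNIV) T) U" "x \<in> U"
  obtains J where "finite J" "J \<subseteq> T" "{y \<in> extensional T. \<forall>j\<in>J. y j = x j} \<subseteq> U"
proof -
  obtain V where V: "finite {a \<in> T. V a \<noteq> UNIV}" "x \<in> Pi\<^sub>E T V" "Pi\<^sub>E T V \<subseteq> U"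
    using assms(1)[unfolded openin_product_topology_alt, rule_format, OF assms(2)] by auto
  show thesis
  proof (rule that[OF V(1)])
    show "{y \<in> extensional T. \<forall>j\<in>{a \<in> T. V a \<noteq> UNIV}. y j = x j} \<subseteq> U"
    proof
      fix y assume y: "y \<in> {y \<in> extensional T. \<forall>j\<in>{a \<in> T. V a \<noteq> UNIV}. y j = x j}"
      have "y a \<in> V a" if "a \<in> T" for a
        using y V(2) that by (cases "V a = UNIV") (auto simp: PiE_iff)
      then have "y \<in> Pi\<^sub>E T V" using y by (simp add: PiE_iff)
      with V(3) show "y \<in> U" by blast
    qed
  qed blast
qed

text \<open>Finite support on two levels: finitely many indices \<open>R\<close> are restricted, and
  for each of them the one-level case supplies finitely many coordinates.\<close>

lemma product_product_discrete_cylinder: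
  assumes "openin (product_topology (\<lambda>R. product_topology (\<lambda>a. discrete_topology UNIV) (T R)) I) U"
    and "x \<in> U"
  obtains J where "finite J" "J \<subseteq> Sigma I T"
    "{y \<in> (\<Pi>\<^sub>E R\<in>I. extensional (T R)). \<forall>(R,a)\<in>J. y R a = x R a} \<subseteq> U"
proof -
  let ?X = "\<lambda>R. product_topology (\<lambda>a. discrete_topology UNIV) (T R)"
  obtain V where V: "finite {R \<in> I. V R \<noteq> topspace (?X R)}" "x \<in> Pi\<^sub>E I V" "Pi\<^sub>E I V \<subseteq> U"
      "\<forall>R\<in>I. openin (?X R) (V R)"
    using openin_product_topology_alt[THEN iffD1, OF assms(1), rule_format, OF assms(2)] by blast
  have "\<forall>R\<in>I. \<exists>J. finite J \<and> J \<subseteq> T R \<and> {y \<in> extensional (T R). \<forall>j\<in>J. y j = x R j} \<subseteq> V R"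
  proof
    fix R assume "R \<in> I"
    then have "openin (?X R) (V R)" "x R \<in> V R" using V(2,4) by (auto simp: PiE_iff)
    then show "\<exists>J. finite J \<and> J \<subseteq> T R \<and> {y \<in> extensional (T R). \<forall>j\<in>J. y j = x R j} \<subseteq> V R"
      by (rule product_discrete_cylinder) blast
  qed
  from bchoice[OF this] obtain J where "\<forall>R\<in>I. finite (J R) \<and> J R \<subseteq> T R \<and>
      {y \<in> extensional (T R). \<forall>j\<in>J R. y j = x R j} \<subseteq> V R" ..
  then have J: "\<And>R. R \<in> I \<Longrightarrow> finite (J R)" "\<And>R. R \<in> I \<Longrightarrow> J R \<subseteq> T R"
      "\<And>R. R \<in> I \<Longrightarrow> {y \<in> extensional (T R). \<forall>j\<in>J R. y j = x R j} \<subseteq> V R"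
    by blast+
  let ?K = "{R \<in> I. V R \<noteq> topspace (?X R)}"
  show thesis
  proof (rule that[of "Sigma ?K J"])
    show "finite (Sigma ?K J)" using V(1) J by auto
    show "Sigma ?K J \<subseteq> Sigma I T" using J(2) by blast
    show "{y \<in> (\<Pi>\<^sub>E R\<in>I. extensional (T R)). \<forall>(R,a)\<in>Sigma ?K J. y R a = x R a} \<subseteq> U"
    proof
      fix y assume y: "y \<in> {y \<in> (\<Pi>\<^sub>E R\<in>I. extensional (T R)). \<forall>(R,a)\<in>Sigma ?K J. y R a = x R a}"
      have "y R \<in> V R" if R: "R \<in> I" for R
      proof (cases "R \<in> ?K")
        case True
        have "y R \<in> extensional (T R)" using y R by (simp add: PiE_iff)
        moreover have "\<forall>j\<in>J R. y R j = x R j" using y True by blast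
        ultimately show ?thesis using J(3)[OF R] by blast
      next
        case False
        then show ?thesis using y R by (auto simp: PiE_iff)
      qed
      then have "y \<in> Pi\<^sub>E I V" using y by (auto simp: PiE_iff)
      with V(3) show "y \<in> U" by blast
    qed
  qed
qed

lemma Str_iff:
  "M \<in> Str L \<longleftrightarrow> fst M \<in> (\<Pi>\<^sub>E R\<in>rel_syms L. extensional (tuples (rel_arity L R))) \<and>
     snd M \<in> (\<Pi>\<^sub>E f\<in>fun_syms L. extensional (tuples (fun_arity L f)))"
  by (cases M) (auto simp: Str_def PiE_iff)

lemma Str_cylinder:
  assumes "openin (Str_topology L) U" "M \<in> U"
  obtains J K where "finite J" "J \<subseteq> Sigma (rel_syms L) (\<lambda>R. tuples (rel_arity L R))"
    "finite K" "K \<subseteq> Sigma (fun_syms L) (\<lambda>f. tuples (fun_arity L f))"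
    "{M'\<in>Str L. (\<forall>(R,as)\<in>J. fst M' R as = fst M R as) \<and> (\<forall>(f,as)\<in>K. snd M' f as = snd M f as)} \<subseteq> U"
proof -
  obtain r s where M: "M = (r, s)" by (cases M)
  obtain V W where VW: "openin (product_topology (\<lambda>R. product_topology (\<lambda>as. discrete_topology (UNIV :: bool set))
        (tuples (rel_arity L R))) (rel_syms L)) V"
     "openin (product_topology (\<lambda>f. product_topology (\<lambda>as. discrete_topology (UNIV :: nat set))
        (tuples (fun_arity L f))) (fun_syms L)) W" "r \<in> V" "s \<in> W" "V \<times> W \<subseteq> U"
    using assms(1)[unfolded Str_topology_def openin_prod_topology_alt, rule_format, OF assms(2)[unfolded M]]
    by blast
  obtain J where J: "finite J" "J \<subseteq> Sigma (rel_syms L) (\<lambda>R. tuples (rel_arity L R))"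
    "{y \<in> (\<Pi>\<^sub>E R\<in>rel_syms L. extensional (tuples (rel_arity L R))). \<forall>(R,a)\<in>J. y R a = r R a} \<subseteq> V"
    by (rule product_product_discrete_cylinder[OF VW(1,3)], rule that)
  obtain K where K: "finite K" "K \<subseteq> Sigma (fun_syms L) (\<lambda>f. tuples (fun_arity L f))"
    "{y \<in> (\<Pi>\<^sub>E f\<in>fun_syms L. extensional (tuples (fun_arity L f))). \<forall>(f,a)\<in>K. y f a = s f a} \<subseteq> W"
    by (rule product_product_discrete_cylinder[OF VW(2,4)], rule that)
  show thesis
  proof (rule that[OF J(1,2) K(1,2)], rule subsetI)
    fix M' assume "M' \<in> {M'\<in>Str L. (\<forall>(R,as)\<in>J. fst M' R as = fst M R as) \<and> (\<forall>(f,as)\<in>K. snd M' f as = snd M f as)}"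
    then have "fst M' \<in> V" "snd M' \<in> W"
      using J(3) K(3) unfolding M Str_iff by auto
    then have "(fst M', snd M') \<in> U" using VW(5) by blast
    then show "M' \<in> U" by simp
  qed
qed

lemma rel_in_Str_borel:
  assumes "R \<in> rel_syms L" "length as = rel_arity L R"
  shows "{M\<in>Str L. fst M R as} \<in> sets (Str_borel L)"
proof -
  let ?X = "\<lambda>R. product_topology (\<lambda>as. discrete_topology (UNIV :: bool set)) (tuples (rel_arity L R))"
  have "continuous_map (Str_topology L) (?X R) ((\<lambda>r. r R) \<circ> fst)"
    unfolding Str_topology_def
    by (rule continuous_map_compose[OF continuous_map_fst continuous_map_product_projection[of R "rel_syms L" ?X]])
       (rule assms)
  moreover have "continuous_map (?X R) (discrete_topology UNIV) (\<lambda>u. u as)"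
    by (rule continuous_map_product_projection) (use assms in \<open>simp add: tuples_def\<close>)
  ultimately have "continuous_map (Str_topology L) (discrete_topology UNIV) ((\<lambda>u. u as) \<circ> ((\<lambda>r. r R) \<circ> fst))"
    by (rule continuous_map_compose)
  from openin_continuous_map_preimage[OF this, of "{True}"]
  have "openin (Str_topology L) {M\<in>Str L. fst M R as}"
    by (simp add: topspace_Str_topology)
  then show ?thesis by (auto simp: sets_Str_borel)
qed

lemma fun_in_Str_borel:
  assumes "f \<in> fun_syms L" "length as = fun_arity L f"
  shows "{M\<in>Str L. snd M f as = b} \<in> sets (Str_borel L)"
proof -
  let ?X = "\<lambda>f. product_topology (\<lambda>as. discrete_topology (UNIV :: nat set)) (tuples (fun_arity L f))"
  have "continuous_map (Str_topology L) (?X f) ((\<lambda>r. r f) \<circ> snd)"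
    unfolding Str_topology_def
    by (rule continuous_map_compose[OF continuous_map_snd continuous_map_product_projection[of f "fun_syms L" ?X]])
       (rule assms)
  moreover have "continuous_map (?X f) (discrete_topology UNIV) (\<lambda>u. u as)"
    by (rule continuous_map_product_projection) (use assms in \<open>simp add: tuples_def\<close>)
  ultimately have "continuous_map (Str_topology L) (discrete_topology UNIV) ((\<lambda>u. u as) \<circ> ((\<lambda>r. r f) \<circ> snd))"
    by (rule continuous_map_compose)
  from openin_continuous_map_preimage[OF this, of "{b}"]
  have "openin (Str_topology L) {M\<in>Str L. snd M f as = b}"
    by (simp add: topspace_Str_topology)
  then show ?thesis by (auto simp: sets_Str_borel)
qed

text \<open>The generators of \<open>Str_borel\<close> are arbitrary open sets. Atomic events
  suffice as a test because a countable language has only countably many cylinders, so every open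
  set is a countable union of cylinders.\<close>

lemma measurable_Str_borel:
  assumes L: "countable_language L"
    and X: "X \<in> space A \<rightarrow> Str L"
    and rel: "\<And>R as. R \<in> rel_syms L \<Longrightarrow> length as = rel_arity L R \<Longrightarrow>
      {\<omega>\<in>space A. fst (X \<omega>) R as} \<in> sets A"
    and fun': "\<And>f as b. f \<in> fun_syms L \<Longrightarrow> length as = fun_arity L f \<Longrightarrow>
      {\<omega>\<in>space A. snd (X \<omega>) f as = b} \<in> sets A"
  shows "X \<in> measurable A (Str_borel L)"
  unfolding Str_borel_def
proof (rule measurable_measure_of)
  show "{U. openin (Str_topology L) U} \<subseteq> Pow (Str L)"
    using openin_subset by (fastforce simp: topspace_Str_topology)
  fix U assume "U \<in> {U. openin (Str_topology L) U}"
  then have U: "openin (Str_topology L) U" by simp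
  define SR where "SR = Sigma (rel_syms L) (\<lambda>R. tuples (rel_arity L R)) \<times> (UNIV :: bool set)"
  define SF where "SF = Sigma (fun_syms L) (\<lambda>f. tuples (fun_arity L f)) \<times> (UNIV :: nat set)"
  have c: "countable SR" "countable SF"
    using L unfolding SR_def SF_def countable_language_def
    by (auto intro!: countable_SIGMA countable_tuples)
  define cyl where "cyl = (\<lambda>(J, K). {M\<in>Str L. (\<forall>((R,as),v)\<in>J. fst M R as = v) \<and> (\<forall>((f,as),v)\<in>K. snd M f as = v)})"
  define C where "C = {JK \<in> {J. finite J \<and> J \<subseteq> SR} \<times> {K. finite K \<and> K \<subseteq> SF}. cyl JK \<subseteq> U}"
  have cC: "countable C"
    unfolding C_def using c
    by (intro countable_Collect countable_SIGMA countable_Collect_finite_subset)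
  have "U = (\<Union>JK\<in>C. cyl JK)"
  proof
    show "(\<Union>JK\<in>C. cyl JK) \<subseteq> U" by (auto simp: C_def)
    show "U \<subseteq> (\<Union>JK\<in>C. cyl JK)"
    proof
      fix M assume M: "M \<in> U"
      from Str_cylinder[OF U M] obtain J K where JK: "finite J" "J \<subseteq> Sigma (rel_syms L) (\<lambda>R. tuples (rel_arity L R))"
    "finite K" "K \<subseteq> Sigma (fun_syms L) (\<lambda>f. tuples (fun_arity L f))"
    "{M'\<in>Str L. (\<forall>(R,as)\<in>J. fst M' R as = fst M R as) \<and> (\<forall>(f,as)\<in>K. snd M' f as = snd M f as)} \<subseteq> U" .
      \<comment> \<open>The cylinder around \<open>M\<close> is coded by the values that
        \<open>M\<close> itself takes on \<open>J\<close> and \<open>K\<close>.\<close>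
      let ?J = "(\<lambda>(R,as). ((R,as), fst M R as)) ` J" and ?K = "(\<lambda>(R,as). ((R,as), snd M R as)) ` K"
      have eq: "cyl (?J, ?K) = {M'\<in>Str L. (\<forall>(R,as)\<in>J. fst M' R as = fst M R as) \<and> (\<forall>(f,as)\<in>K. snd M' f as = snd M f as)}"
        unfolding cyl_def by auto
      have "M \<in> Str L" using openin_subset[OF U] M by (auto simp: topspace_Str_topology)
      then have "M \<in> cyl (?J, ?K)" unfolding eq by auto
      moreover have "(?J, ?K) \<in> C"
        using JK eq unfolding C_def SR_def SF_def by auto
      ultimately show "M \<in> (\<Union>JK\<in>C. cyl JK)" by blast
    qed
  qed
  then have "X -` U \<inter> space A = (\<Union>JK\<in>C. X -` cyl JK \<inter> space A)" by auto
  also have "\<dots> \<in> sets A"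
  proof (rule sets.countable_UN''[OF cC])
    fix JK assume "JK \<in> C"
    then obtain J K where JK: "JK = (J, K)" "finite J" "J \<subseteq> SR" "finite K" "K \<subseteq> SF"
      by (auto simp: C_def)
    have 1: "{\<omega>\<in>space A. fst (X \<omega>) R as = v} \<in> sets A" if "((R,as),v) \<in> J" for R as v
    proof (cases v)
      case True
      then show ?thesis using rel[of R as] that JK by (auto simp: SR_def tuples_def)
    next
      case False
      then have "{\<omega>\<in>space A. fst (X \<omega>) R as = v} = space A - {\<omega>\<in>space A. fst (X \<omega>) R as}" by auto
      then show ?thesis using rel[of R as] that JK by (auto simp: SR_def tuples_def)
    qed
    have 2: "{\<omega>\<in>space A. snd (X \<omega>) f as = v} \<in> sets A" if "((f,as),v) \<in> K" for f as v
      using fun'[of f as v] that JK by (auto simp: SF_def tuples_def)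
    have "X -` cyl JK \<inter> space A = {\<omega>\<in>space A. (\<forall>t\<in>J. fst (X \<omega>) (fst (fst t)) (snd (fst t)) = snd t)} \<inter>
        {\<omega>\<in>space A. (\<forall>t\<in>K. snd (X \<omega>) (fst (fst t)) (snd (fst t)) = snd t)}"
      using X unfolding JK(1) cyl_def by (auto simp: case_prod_beta Pi_iff)
    also have "\<dots> \<in> sets A"
      using 1 2 by (intro sets.Int sets.sets_Collect_finite_All' JK sets.sets_Collect_finite_All) auto
    finally show "X -` cyl JK \<inter> space A \<in> sets A" .
  qed
  finally show "X -` U \<inter> space A \<in> sets A" .
qed (use X in auto)

section \<open>Measurability and invertibility of the logic action\<close>

lemma measurable_logic_action:
  assumes L: "countable_language L" and g: "bij g"
  shows "logic_action L g \<in> measurable (Str_borel L) (Str_borel L)"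
proof (rule measurable_Str_borel[OF L])
  show "logic_action L g \<in> space (Str_borel L) \<rightarrow> Str L" by (simp add: logic_action_in_Str)
  show "{\<omega>\<in>space (Str_borel L). fst (logic_action L g \<omega>) R as} \<in> sets (Str_borel L)"
    if "R \<in> rel_syms L" "length as = rel_arity L R" for R as
    using rel_in_Str_borel[of R L "map (inv g) as"] that
    by (simp add: logic_action_rel space_Str_borel)
  show "{\<omega>\<in>space (Str_borel L). snd (logic_action L g \<omega>) f as = b} \<in> sets (Str_borel L)"
    if "f \<in> fun_syms L" "length as = fun_arity L f" for f as b
  proof -
    have "{\<omega>\<in>space (Str_borel L). snd (logic_action L g \<omega>) f as = b} =
       {M\<in>Str L. snd M f (map (inv g) as) = inv g b}"
      unfolding space_Str_borel using logic_action_fun[OF g that, of b] by metis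
    then show ?thesis using fun_in_Str_borel[of f L "map (inv g) as"] that by simp
  qed
qed

lemma Str_eqI:
  assumes "M \<in> Str L" "M' \<in> Str L"
    and "\<And>R as. R \<in> rel_syms L \<Longrightarrow> length as = rel_arity L R \<Longrightarrow> fst M R as = fst M' R as"
    and "\<And>f as. f \<in> fun_syms L \<Longrightarrow> length as = fun_arity L f \<Longrightarrow> snd M f as = snd M' f as"
  shows "M = M'"
proof (rule prod_eqI)
  show "fst M = fst M'"
  proof (rule PiE_ext)
    show "fst M \<in> (\<Pi>\<^sub>E R\<in>rel_syms L. extensional (tuples (rel_arity L R)))"
      "fst M' \<in> (\<Pi>\<^sub>E R\<in>rel_syms L. extensional (tuples (rel_arity L R)))"
      using assms by (auto simp: Str_iff)
    then show "fst M R = fst M' R" if "R \<in> rel_syms L" for R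
      using assms(3) that
      by (intro extensionalityI[of _ "tuples (rel_arity L R)"]) (auto simp: tuples_def PiE_iff)
  qed
  show "snd M = snd M'"
  proof (rule PiE_ext)
    show "snd M \<in> (\<Pi>\<^sub>E R\<in>fun_syms L. extensional (tuples (fun_arity L R)))"
      "snd M' \<in> (\<Pi>\<^sub>E R\<in>fun_syms L. extensional (tuples (fun_arity L R)))"
      using assms by (auto simp: Str_iff)
    then show "snd M R = snd M' R" if "R \<in> fun_syms L" for R
      using assms(4) that
      by (intro extensionalityI[of _ "tuples (fun_arity L R)"]) (auto simp: tuples_def PiE_iff)
  qed
qed

lemma logic_action_inv:
  assumes g: "bij g" and M: "M \<in> Str L"
  shows "logic_action L (inv g) (logic_action L g M) = M"
proof (rule Str_eqI[OF logic_action_in_Str M])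
  have i: "inv (inv g) = g" "inv g \<circ> g = id" using g by (auto simp: inv_inv_eq bij_is_inj)
  then have i': "inv g (g x) = x" for x by (metis comp_apply id_apply)
  show "fst (logic_action L (inv g) (logic_action L g M)) R as = fst M R as"
    if "R \<in> rel_syms L" "length as = rel_arity L R" for R as
    using that i by (simp add: logic_action_rel)
  show "snd (logic_action L (inv g) (logic_action L g M)) f as = snd M f as"
    if "f \<in> fun_syms L" "length as = fun_arity L f" for f as
    using that i i' by (simp add: logic_action_def tuples_def)
qed

lemma logic_action_inv':
  assumes "bij g" "M \<in> Str L"
  shows "logic_action L g (logic_action L (inv g) M) = M"
  using logic_action_inv[OF bij_imp_bij_inv[OF assms(1)] assms(2)] assms by (simp add: inv_inv_eq)

text \<open>Images become preimages under the inverse permutation, so measurability of the action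
  also shows that it maps Borel sets to Borel sets.\<close>

lemma logic_action_image:
  assumes "bij g" "B \<subseteq> Str L"
  shows "logic_action L g ` B = logic_action L (inv g) -` B \<inter> Str L"
proof (intro equalityI subsetI)
  fix M assume "M \<in> logic_action L g ` B"
  then obtain M' where M': "M' \<in> B" "M = logic_action L g M'" by blast
  then have "logic_action L (inv g) M = M'" using assms logic_action_inv[OF assms(1), of M' L] by blast
  then show "M \<in> logic_action L (inv g) -` B \<inter> Str L" using M' logic_action_in_Str by simp
next
  fix M assume M: "M \<in> logic_action L (inv g) -` B \<inter> Str L"
  then have "M = logic_action L g (logic_action L (inv g) M)"
    using assms(1) by (simp add: logic_action_inv')
  then show "M \<in> logic_action L g ` B" using M by blast
qed

section \<open>Composition and inversion of isomorphisms\<close>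

lemma isomorphism_comp:
  assumes "isomorphism L M1 M2 h" "isomorphism L M2 M3 k"
  shows "isomorphism L M1 M3 (k \<circ> h)"
  using assms unfolding isomorphism_def tuples_def by (auto intro: bij_comp)

lemma isomorphism_inv:
  assumes "isomorphism L M M' h"
  shows "isomorphism L M' M (inv h)"
proof -
  have h: "bij h" and i: "h (inv h x) = x" "inv h (h x) = x" for x
    using assms by (auto simp: isomorphism_def bij_is_surj surj_f_inv_f bij_is_inj)
  have m: "map h (map (inv h) as) = as" for as by (simp add: o_def i)
  show ?thesis
    unfolding isomorphism_def
  proof (intro conjI ballI)
    show "bij (inv h)" using h by (rule bij_imp_bij_inv)
    fix R as assume "R \<in> rel_syms L" "as \<in> tuples (rel_arity L R)"
    then show "fst M' R as = fst M R (map (inv h) as)"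
      using assms m unfolding isomorphism_def tuples_def
      by (smt (verit) length_map mem_Collect_eq)
  next
    fix f as assume "f \<in> fun_syms L" "as \<in> tuples (fun_arity L f)"
    then have "h (snd M f (map (inv h) as)) = snd M' f as"
      using assms m unfolding isomorphism_def tuples_def
      by (smt (verit) length_map mem_Collect_eq)
    then show "inv h (snd M' f as) = snd M f (map (inv h) as)" using i by metis
  qed
qed

lemma isomorphism_id: "isomorphism L M M id"
  by (simp add: isomorphism_def)

lemma isomorphism_logic_action:
  assumes "bij g"
  shows "isomorphism L M (logic_action L g M) g"
  using assms unfolding isomorphism_def
  by (auto simp: logic_action_def tuples_def o_def bij_is_inj)

section \<open>Scott analysis\<close>

text \<open>Stage \<open>n\<close> forces the number \<open>n\<close> into both lists, and
  \<open>eq\<close> makes the union of the finite correspondences the graph of a bijection. The last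
  conclusion returns related tuples that cover any initial segment, since what is later read off
  from \<open>h\<close> concerns finitely many points at a time.\<close>

lemma back_and_forth:
  fixes P :: "nat list \<Rightarrow> nat list \<Rightarrow> bool"
  assumes P0: "P x0 a0"
    and len: "\<And>x a. P x a \<Longrightarrow> length x = length a"
    and eq: "\<And>x a i j. P x a \<Longrightarrow> i < length x \<Longrightarrow> j < length x \<Longrightarrow> x ! i = x ! j \<longleftrightarrow> a ! i = a ! j"
    and fwd: "\<And>x a y. P x a \<Longrightarrow> \<exists>b. P (x @ [y]) (a @ [b])"
    and bwd: "\<And>x a b. P x a \<Longrightarrow> \<exists>y. P (x @ [y]) (a @ [b])"
  obtains h where "bij h" "map h x0 = a0" "\<And>n. \<exists>x. P x (map h x) \<and> {..<n} \<subseteq> set x"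
proof -
  \<comment> \<open>The second conjunct pins the start of the chain, which dependent choice would
    otherwise leave free.\<close>
  let ?P = "\<lambda>n p. P (fst p) (snd p) \<and> (n = 0 \<longrightarrow> p = (x0, a0))"
  let ?Q = "\<lambda>n p q. (\<exists>u. fst q = fst p @ u) \<and> (\<exists>v. snd q = snd p @ v) \<and> n \<in> set (fst q) \<and> n \<in> set (snd q)"
  have "\<exists>s. \<forall>n. ?P n (s n) \<and> ?Q n (s n) (s (Suc n))"
  proof (rule dependent_nat_choice)
    show "\<exists>p. ?P 0 p" using P0 by auto
    fix p and n :: nat assume "?P n p"
    then obtain b where b: "P (fst p @ [n]) (snd p @ [b])" using fwd by blast
    from bwd[OF b, of n] obtain y where "P (fst p @ [n, y]) (snd p @ [b, n])" by auto
    then show "\<exists>q. ?P (Suc n) q \<and> ?Q n p q"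
      by (intro exI[of _ "(fst p @ [n, y], snd p @ [b, n])"]) simp
  qed
  then obtain s where s: "\<And>n. ?P n (s n)" "\<And>n. ?Q n (s n) (s (Suc n))" by blast
  define X where "X n = fst (s n)" for n
  define A where "A n = snd (s n)" for n
  have PX: "P (X n) (A n)" and X0: "X 0 = x0" "A 0 = a0" for n
    using s(1)[of n] s(1)[of 0] by (auto simp: X_def A_def)
  have XS: "\<exists>u. X (Suc n) = X n @ u" and AS: "\<exists>u. A (Suc n) = A n @ u"
    and inX: "n \<in> set (X (Suc n))" and inA: "n \<in> set (A (Suc n))" for n
    using s(2)[of n] by (auto simp: X_def A_def)
  have lenXA: "length (X n) = length (A n)" for n by (rule len[OF PX])
  define r where "r n = set (zip (X n) (A n))" for n
  have "r n \<subseteq> r (Suc n)" for n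
  proof -
    obtain u v where "X (Suc n) = X n @ u" "A (Suc n) = A n @ v" using XS AS by blast
    then show ?thesis using lenXA[of n] by (simp add: r_def)
  qed
  then have mono_r: "mono r" by (simp add: mono_iff_le_Suc)
  have r_iff: "(y, b) \<in> r n \<longleftrightarrow> (\<exists>i < length (X n). y = X n ! i \<and> b = A n ! i)" for y b n
    using lenXA[of n] by (auto simp: r_def in_set_zip)
  have inj_r: "y = y' \<longleftrightarrow> b = b'" if "(y, b) \<in> r n" "(y', b') \<in> r m" for y b y' b' n m
  proof -
    have "(y, b) \<in> r (max n m)" "(y', b') \<in> r (max n m)"
      using that monoD[OF mono_r, of n "max n m"] monoD[OF mono_r, of m "max n m"] by auto
    then show ?thesis unfolding r_iff using eq[OF PX] by blast
  qed
  have tot: "\<exists>b n. (y, b) \<in> r n" for y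
    using inX[of y] lenXA[of "Suc y"] unfolding r_iff in_set_conv_nth by metis
  have sur: "\<exists>y n. (y, b) \<in> r n" for b
    using inA[of b] lenXA[of "Suc b"] unfolding r_iff in_set_conv_nth by metis
  obtain h where h: "\<And>y. \<exists>n. (y, h y) \<in> r n" using tot by metis
  have hr: "h y = b" if "(y, b) \<in> r n" for y b n using h[of y] inj_r[OF _ that] by blast
  have mapX: "map h (X n) = A n" for n
  proof (rule nth_equalityI)
    fix i assume "i < length (map h (X n))"
    then show "map h (X n) ! i = A n ! i" using hr[of "X n ! i" "A n ! i" n] by (auto simp: r_iff)
  qed (simp add: lenXA)
  have "bij h"
  proof (rule bijI)
    show "inj h" using h inj_r by (metis injI)
    show "surj h" using hr sur by (metis surjI)
  qed
  moreover have "map h x0 = a0" using mapX[of 0] X0 by simp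
  moreover have "\<exists>x. P x (map h x) \<and> {..<n} \<subseteq> set x" for n
  proof (intro exI conjI subsetI)
    show "P (X n) (map h (X n))" using PX mapX by simp
    fix m assume "m \<in> {..<n}"
    then have "r (Suc m) \<subseteq> r n" by (intro monoD[OF mono_r]) auto
    moreover obtain b where "(m, b) \<in> r (Suc m)"
      using inX[of m] unfolding r_iff in_set_conv_nth by metis
    ultimately have "(m, b) \<in> r n" by blast
    then show "m \<in> set (X n)" unfolding r_iff by auto
  qed
  ultimately show thesis by (rule that)
qed

section \<open>Invariant Borel formulas\<close>

text \<open>A semantic substitute for formulas of the infinitary logic with countable conjunctions:
  instead of syntax, only Borel dependence on the structure and invariance under isomorphism are
  kept.\<close>

definition inv_formula :: "('r, 'f) language \<Rightarrow> (('r, 'f) struct \<Rightarrow> nat list \<Rightarrow> bool) \<Rightarrow> bool" where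
  "inv_formula L \<phi> \<longleftrightarrow> (\<forall>x. Measurable.pred (Str_borel L) (\<lambda>M. \<phi> M x)) \<and>
     (\<forall>M\<in>Str L. \<forall>M'\<in>Str L. \<forall>h x. isomorphism L M M' h \<longrightarrow> (\<phi> M x \<longleftrightarrow> \<phi> M' (map h x)))"

lemma inv_formula_iso:
  assumes "inv_formula L \<phi>" "M \<in> Str L" "M' \<in> Str L" "isomorphism L M M' h"
  shows "\<phi> M x \<longleftrightarrow> \<phi> M' (map h x)"
  using assms unfolding inv_formula_def by blast

lemma inv_formula_not: "inv_formula L \<phi> \<Longrightarrow> inv_formula L (\<lambda>M x. \<not> \<phi> M x)"
  unfolding inv_formula_def by (simp add: pred_intros_logic)

lemma inv_formula_all:
  assumes "\<And>i :: 'i :: countable. i \<in> I \<Longrightarrow> inv_formula L (\<phi> i)"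
  shows "inv_formula L (\<lambda>M x. \<forall>i\<in>I. \<phi> i M x)"
  using assms unfolding inv_formula_def
  by (auto intro!: pred_intros_countable_bounded)

lemma inv_formula_conj:
  "inv_formula L \<phi> \<Longrightarrow> inv_formula L \<psi> \<Longrightarrow> inv_formula L (\<lambda>M x. \<phi> M x \<and> \<psi> M x)"
  unfolding inv_formula_def by (auto intro!: pred_intros_logic)

text \<open>Measurability holds because the domain is countable, invariance because an isomorphism
  is onto.\<close>

lemma inv_formula_ex:
  assumes "inv_formula L \<phi>"
  shows "inv_formula L (\<lambda>M x. \<exists>y. \<phi> M (x @ [y]))"
  unfolding inv_formula_def
proof (intro conjI allI ballI impI)
  show "Measurable.pred (Str_borel L) (\<lambda>M. \<exists>y. \<phi> M (x @ [y]))" for x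
    using assms unfolding inv_formula_def by (intro pred_intros_countable) auto
  fix M M' h x assume M: "M \<in> Str L" "M' \<in> Str L" "isomorphism L M M' h"
  then have "surj h" by (simp add: isomorphism_def bij_is_surj)
  have "\<phi> M (x @ [y]) \<longleftrightarrow> \<phi> M' (map h x @ [h y])" for y
    using inv_formula_iso[OF assms M, of "x @ [y]"] by simp
  then show "(\<exists>y. \<phi> M (x @ [y])) \<longleftrightarrow> (\<exists>y. \<phi> M' (map h x @ [y]))"
    using \<open>surj h\<close> by (metis surjD)
qed

text \<open>The type of \<open>a\<close> in \<open>N\<close> with respect to unnested atomic
  formulas. Index lists \<open>js\<close> address entries of the two tuples simultaneously, and a
  function value is recorded only by comparison with entries of the tuple.\<close>

definition same_atoms ::
  "('r, 'f) language \<Rightarrow> ('r, 'f) struct \<Rightarrow> nat list \<Rightarrow> ('r, 'f) struct \<Rightarrow> nat list \<Rightarrow> bool" where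
  "same_atoms L N a M x \<longleftrightarrow> length x = length a \<and>
     (\<forall>i\<in>{..<length a}. \<forall>j\<in>{..<length a}. x ! i = x ! j \<longleftrightarrow> a ! i = a ! j) \<and>
     (\<forall>R\<in>rel_syms L. \<forall>js\<in>{js. set js \<subseteq> {..<length a} \<and> length js = rel_arity L R}.
        fst M R (map ((!) x) js) \<longleftrightarrow> fst N R (map ((!) a) js)) \<and>
     (\<forall>f\<in>fun_syms L. \<forall>js\<in>{js. set js \<subseteq> {..<length a} \<and> length js = fun_arity L f}. \<forall>k\<in>{..<length a}.
        snd M f (map ((!) x) js) = x ! k \<longleftrightarrow> snd N f (map ((!) a) js) = a ! k)"

lemma pred_countable_ball:
  assumes "countable I" "\<And>i. i \<in> I \<Longrightarrow> Measurable.pred A (P i)"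
  shows "Measurable.pred A (\<lambda>x. \<forall>i\<in>I. P i x)"
  using assms unfolding pred_def by (intro sets.sets_Collect_countable_All')

lemma inv_formula_same_atoms:
  assumes L: "countable_language L"
  shows "inv_formula L (same_atoms L N a)"
  unfolding inv_formula_def
proof (intro conjI allI ballI impI)
  fix x
  have c: "countable (rel_syms L)" "countable (fun_syms L)" using L by (auto simp: countable_language_def)
  show "Measurable.pred (Str_borel L) (\<lambda>M. same_atoms L N a M x)"
    unfolding same_atoms_def
  proof (intro pred_intros_logic(3) pred_countable_ball c)
    fix R js assume "R \<in> rel_syms L" "js \<in> {js. set js \<subseteq> {..<length a} \<and> length js = rel_arity L R}"
    then have "Measurable.pred (Str_borel L) (\<lambda>M. fst M R (map ((!) x) js))"
      using rel_in_Str_borel[of R L "map ((!) x) js"] by (simp add: pred_def space_Str_borel)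
    then show "Measurable.pred (Str_borel L) (\<lambda>M. fst M R (map ((!) x) js) \<longleftrightarrow> fst N R (map ((!) a) js))"
      by measurable
  next
    fix f js k assume "f \<in> fun_syms L" "js \<in> {js. set js \<subseteq> {..<length a} \<and> length js = fun_arity L f}"
    then have "Measurable.pred (Str_borel L) (\<lambda>M. snd M f (map ((!) x) js) = x ! k)"
      using fun_in_Str_borel[of f L "map ((!) x) js"] by (simp add: pred_def space_Str_borel)
    then show "Measurable.pred (Str_borel L) (\<lambda>M. snd M f (map ((!) x) js) = x ! k \<longleftrightarrow> snd N f (map ((!) a) js) = a ! k)"
      by measurable
  qed (simp_all add: countableI_type)
next
  fix M M' h x assume M: "M \<in> Str L" "M' \<in> Str L" and iso: "isomorphism L M M' h"
  then have inj: "inj h" by (simp add: isomorphism_def bij_is_inj)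
  show "same_atoms L N a M x \<longleftrightarrow> same_atoms L N a M' (map h x)"
  proof (cases "length x = length a")
    case True
    have mm: "map h (map ((!) x) js) = map ((!) (map h x)) js" if "set js \<subseteq> {..<length a}" for js
      using that True by auto
    have 1: "fst M R (map ((!) x) js) \<longleftrightarrow> fst M' R (map ((!) (map h x)) js)"
      if "R \<in> rel_syms L" "set js \<subseteq> {..<length a}" "length js = rel_arity L R" for R js
      unfolding mm[OF that(2), symmetric] using that iso by (simp add: isomorphism_def tuples_def)
    have 2: "snd M f (map ((!) x) js) = x ! k \<longleftrightarrow> snd M' f (map ((!) (map h x)) js) = map h x ! k"
      if "f \<in> fun_syms L" "set js \<subseteq> {..<length a}" "length js = fun_arity L f" "k < length a" for f js k
    proof -
      have "h (snd M f (map ((!) x) js)) = snd M' f (map ((!) (map h x)) js)"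
        unfolding mm[OF that(2), symmetric] using that iso by (simp add: isomorphism_def tuples_def)
      then show ?thesis using that True inj by (auto simp: inj_eq)
    qed
    have 3: "x ! i = x ! j \<longleftrightarrow> map h x ! i = map h x ! j" if "i < length a" "j < length a" for i j
      using that True inj by (simp add: inj_eq)
    show ?thesis
      unfolding same_atoms_def using True 1 2 3 by simp
  qed (simp add: same_atoms_def)
qed

section \<open>Borel sets of copies with a prescribed orbit type\<close>

text \<open>The event that \<open>x\<close> in the copy \<open>M\<close> plays the role of
  \<open>a\<close> in \<open>N\<close>, up to automorphisms of \<open>N\<close>. Empty tuples give
  the isomorphism class.\<close>

definition tp_set ::
  "('r, 'f) language \<Rightarrow> ('r, 'f) struct \<Rightarrow> nat list \<Rightarrow> nat list \<Rightarrow> ('r, 'f) struct set" where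
  "tp_set L N a x = {M \<in> Str L. \<exists>h. isomorphism L M N h \<and> map h x = a}"

text \<open>Scott analysis without ordinals: the complete type of a tuple with respect to all invariant
  formulas is isolated by a single one of them, because there are only countably many tuples.\<close>

lemma isolating_formulas:
  assumes L: "countable_language L" and N: "N \<in> Str L"
  obtains \<tau> where "\<And>a. inv_formula L (\<tau> a)" "\<And>a. \<tau> a N a"
    "\<And>a M x. \<tau> a M x \<Longrightarrow> same_atoms L N a M x"
    "\<And>a b y. \<tau> a N b \<Longrightarrow> \<exists>c. \<tau> (a @ [c]) N (b @ [y])"
    "\<And>a b c. \<tau> a N b \<Longrightarrow> \<exists>y. \<tau> (a @ [c]) N (b @ [y])"
proof -
  define E where "E a b \<longleftrightarrow> (\<forall>\<phi>. inv_formula L \<phi> \<longrightarrow> (\<phi> N a \<longleftrightarrow> \<phi> N b))" for a b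
  \<comment> \<open>Some invariant formula distinguishes \<open>a\<close> from \<open>b\<close>;
    replaced by its negation if necessary, it holds at \<open>a\<close>.\<close>
  have "\<exists>\<phi>. \<forall>b. \<not> E a b \<longrightarrow> inv_formula L (\<phi> b) \<and> \<phi> b N a \<and> \<not> \<phi> b N b" for a
  proof (rule choice, rule allI)
    fix b
    show "\<exists>\<phi>. \<not> E a b \<longrightarrow> inv_formula L \<phi> \<and> \<phi> N a \<and> \<not> \<phi> N b"
      unfolding E_def using inv_formula_not by metis
  qed
  then obtain \<phi> where \<phi>: "\<And>a b. \<not> E a b \<Longrightarrow> inv_formula L (\<phi> a b) \<and> \<phi> a b N a \<and> \<not> \<phi> a b N b"
    by metis
  \<comment> \<open>There are only countably many tuples \<open>b\<close>, so this conjunction is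
    again an invariant formula. Including \<open>same_atoms\<close> controls the atoms in every
    structure \<open>M\<close>, not only in \<open>N\<close>.\<close>
  define \<tau> where "\<tau> a M x \<longleftrightarrow> same_atoms L N a M x \<and> (\<forall>b\<in>{b. \<not> E a b}. \<phi> a b M x)" for a M x
  have inv: "inv_formula L (\<tau> a)" for a
    unfolding \<tau>_def[abs_def]
    by (intro inv_formula_conj inv_formula_all inv_formula_same_atoms L) (use \<phi> in auto)
  have \<tau>a: "\<tau> a N a" for a
    using \<phi> by (auto simp: \<tau>_def same_atoms_def)
  have \<tau>E: "\<tau> a N b \<longleftrightarrow> E a b" for a b
  proof
    show "\<tau> a N b \<Longrightarrow> E a b" using \<phi> unfolding \<tau>_def by blast
    show "E a b \<Longrightarrow> \<tau> a N b" using \<tau>a[of a] inv[of a] unfolding E_def by blast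
  qed
  have Esym: "E a b \<Longrightarrow> E b a" for a b by (auto simp: E_def)
  have extend: "\<exists>c. E (b @ [y]) (a @ [c])" if "E a b" for a b y
  proof -
    \<comment> \<open>This is witnessed by \<open>c = y\<close>. The existential closure is itself
      an invariant formula, so \<open>E\<close> transfers it from \<open>b\<close> to
      \<open>a\<close>.\<close>
    have "\<exists>c. \<tau> (b @ [y]) N (b @ [c])" using \<tau>a by blast
    then have "\<exists>c. \<tau> (b @ [y]) N (a @ [c])"
      using that inv_formula_ex[OF inv[of "b @ [y]"]] unfolding E_def by blast
    then show ?thesis unfolding \<tau>E .
  qed
  show thesis
  proof (rule that[of \<tau>, OF inv \<tau>a])
    show "\<tau> a M x \<Longrightarrow> same_atoms L N a M x" for a M x by (simp add: \<tau>_def)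
    show "\<exists>c. \<tau> (a @ [c]) N (b @ [y])" if "\<tau> a N b" for a b y
      using that extend Esym unfolding \<tau>E by blast
    show "\<exists>y. \<tau> (a @ [c]) N (b @ [y])" if "\<tau> a N b" for a b c
      using that extend Esym unfolding \<tau>E by blast
  qed
qed

text \<open>A single instance of a symbol involves finitely many numbers, its value included, so it
  is visible inside one of the tuples on which the atoms agree.\<close>

lemma isomorphism_if_same_atoms:
  assumes "bij h" and loc: "\<And>n. \<exists>x. same_atoms L N (map h x) M x \<and> {..<n} \<subseteq> set x"
  shows "isomorphism L M N h"
proof -
  have covered: "\<exists>x js k. same_atoms L N (map h x) M x \<and> set js \<subseteq> {..<length x} \<and> ys = map ((!) x) js \<and>
     k < length x \<and> y = x ! k" for ys y
  proof -
    obtain n where "set (y # ys) \<subseteq> {..<n}" using finite_nat_bounded[of "set (y # ys)"] by auto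
    then obtain x where x: "same_atoms L N (map h x) M x" "set ys \<subseteq> set x" "y \<in> set x"
      using loc[of n] by auto
    then have "\<exists>js. set js \<subseteq> {..<length x} \<and> ys = map ((!) x) js"
    proof (induction ys)
      case (Cons y ys)
      then obtain js where "set js \<subseteq> {..<length x}" "ys = map ((!) x) js" by auto
      moreover obtain j where "j < length x" "y = x ! j" using Cons by (auto simp: in_set_conv_nth)
      ultimately show ?case by (intro exI[of _ "j # js"]) auto
    qed auto
    with x show ?thesis by (metis in_set_conv_nth)
  qed
  show ?thesis
    unfolding isomorphism_def
  proof (intro conjI ballI \<open>bij h\<close>)
    fix R ys assume R: "R \<in> rel_syms L" "ys \<in> tuples (rel_arity L R)"
    obtain x js where x: "same_atoms L N (map h x) M x" "set js \<subseteq> {..<length x}" "ys = map ((!) x) js"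
      using covered by blast
    then have m: "map h ys = map ((!) (map h x)) js" by auto
    show "fst M R ys \<longleftrightarrow> fst N R (map h ys)"
      unfolding m using x R by (simp add: same_atoms_def tuples_def)
  next
    fix f ys assume f: "f \<in> fun_syms L" "ys \<in> tuples (fun_arity L f)"
    obtain x js k where x: "same_atoms L N (map h x) M x" "set js \<subseteq> {..<length x}" "ys = map ((!) x) js"
      "k < length x" "snd M f ys = x ! k"
      using covered[of ys "snd M f ys"] by blast
    then have m: "map h ys = map ((!) (map h x)) js" by auto
    have "snd M f (map ((!) x) js) = x ! k \<longleftrightarrow> snd N f (map ((!) (map h x)) js) = map h x ! k"
      using x f unfolding same_atoms_def tuples_def by simp
    then show "h (snd M f ys) = snd N f (map h ys)"
      unfolding m using x by simp
  qed
qed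

text \<open>Borel form of Scott's isomorphism theorem. The predicate \<open>S\<close> plays the part
  of the Scott sentence: the isolating formulas have the back-and-forth property in
  \<open>M\<close>. This is a countable condition, and back-and-forth from \<open>x\<close> and
  \<open>a\<close> turns it into an isomorphism.\<close>

lemma tp_set_Borel:
  assumes L: "countable_language L" and N: "N \<in> Str L"
  shows "tp_set L N a x \<in> sets (Str_borel L)"
proof -
  obtain \<tau> where \<tau>: "\<And>a. inv_formula L (\<tau> a)" "\<And>a. \<tau> a N a"
    "\<And>a M x. \<tau> a M x \<Longrightarrow> same_atoms L N a M x"
    and fwd: "\<And>a b y. \<tau> a N b \<Longrightarrow> \<exists>c. \<tau> (a @ [c]) N (b @ [y])"
    and bwd: "\<And>a b c. \<tau> a N b \<Longrightarrow> \<exists>y. \<tau> (a @ [c]) N (b @ [y])"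
    using isolating_formulas[OF assms] by blast
  define S where "S M \<longleftrightarrow> (\<forall>a z. \<tau> a M z \<longrightarrow>
      (\<forall>y. \<exists>b. \<tau> (a @ [b]) M (z @ [y])) \<and> (\<forall>b. \<exists>y. \<tau> (a @ [b]) M (z @ [y])))" for M
  have [measurable]: "Measurable.pred (Str_borel L) (\<lambda>M. \<tau> a M z)" for a z
    using \<tau>(1) by (simp add: inv_formula_def)
  have "Measurable.pred (Str_borel L) (\<lambda>M. S M \<and> \<tau> a M x)"
    unfolding S_def by measurable
  then have "{M \<in> Str L. S M \<and> \<tau> a M x} \<in> sets (Str_borel L)"
    by (simp add: pred_def space_Str_borel)
  moreover have "tp_set L N a x = {M \<in> Str L. S M \<and> \<tau> a M x}"
  proof (intro equalityI subsetI)
    fix M assume "M \<in> tp_set L N a x"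
    then obtain h where M: "M \<in> Str L" and h: "isomorphism L M N h" "map h x = a"
      by (auto simp: tp_set_def)
    have tr: "\<tau> a M z \<longleftrightarrow> \<tau> a N (map h z)" for a z
      by (rule inv_formula_iso[OF \<tau>(1) M N h(1)])
    have "surj h" using h by (simp add: isomorphism_def bij_is_surj)
    have "S M"
      unfolding S_def
    proof (intro allI impI conjI)
      fix a z assume az: "\<tau> a M z"
      show "\<exists>b. \<tau> (a @ [b]) M (z @ [y])" for y using fwd az unfolding tr by simp
      show "\<exists>y. \<tau> (a @ [b]) M (z @ [y])" for b
      proof -
        obtain y where "\<tau> (a @ [b]) N (map h z @ [y])" using bwd az unfolding tr by blast
        moreover obtain y' where "y = h y'" using \<open>surj h\<close> by (rule surjE)
        ultimately show ?thesis unfolding tr by auto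
      qed
    qed
    moreover have "\<tau> a M x" using \<tau>(2) h tr by simp
    ultimately show "M \<in> {M \<in> Str L. S M \<and> \<tau> a M x}" using M by simp
  next
    fix M assume "M \<in> {M \<in> Str L. S M \<and> \<tau> a M x}"
    then have M: "M \<in> Str L" "S M" "\<tau> a M x" by auto
    obtain h where h: "bij h" "map h x = a" "\<And>n. \<exists>x. \<tau> (map h x) M x \<and> {..<n} \<subseteq> set x"
    proof (rule back_and_forth[of "\<lambda>x a. \<tau> a M x" x a])
      show "length x = length a" if "\<tau> a M x" for x a
        using \<tau>(3)[OF that] by (simp add: same_atoms_def)
      show "x ! i = x ! j \<longleftrightarrow> a ! i = a ! j" if "\<tau> a M x" "i < length x" "j < length x" for x a i j
        using \<tau>(3)[OF that(1)] that(2,3) by (simp add: same_atoms_def)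
    qed (use M in \<open>auto simp: S_def\<close>)
    then have "isomorphism L M N h"
      using \<tau>(3) by (intro isomorphism_if_same_atoms) blast+
    then show "M \<in> tp_set L N a x" using M(1) h(2) by (auto simp: tp_set_def)
  qed
  ultimately show ?thesis by simp
qed

lemma tp_set_Nil: "tp_set L N [] [] = iso_class L N"
  by (simp add: tp_set_def iso_class_def)

lemma logic_action_tp_set:
  assumes "bij g"
  shows "logic_action L g ` tp_set L N a x \<subseteq> tp_set L N a (map g x)"
proof
  fix M' assume "M' \<in> logic_action L g ` tp_set L N a x"
  then obtain M h where M: "M \<in> Str L" "isomorphism L M N h" "map h x = a" "M' = logic_action L g M"
    by (auto simp: tp_set_def)
  have "isomorphism L M' N (h \<circ> inv g)"
    using isomorphism_comp[OF isomorphism_inv[OF isomorphism_logic_action[OF assms]] M(2)] M(4) by simp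
  moreover have "map (h \<circ> inv g) (map g x) = a"
    using assms M(3) by (simp add: o_def bij_is_inj)
  ultimately show "M' \<in> tp_set L N a (map g x)"
    unfolding M(4) tp_set_def using logic_action_in_Str by blast
qed

section \<open>Highly algebraic structures\<close>

text \<open>Fix one isomorphism \<open>h0\<close> taking \<open>xs\<close> to \<open>as\<close>. If
  \<open>h\<close> also does and maps \<open>w\<close> to \<open>b\<close>, then
  \<open>h0 \<circ> inv h\<close> is an automorphism fixing \<open>as\<close> and taking
  \<open>b\<close> to \<open>h0 w\<close>. So \<open>h0\<close> injects the candidates
  \<open>w\<close> into the finite orbit of \<open>b\<close>, with a bound independent of
  \<open>M\<close> and \<open>xs\<close>.\<close>

lemma card_tp_set_fiber:
  assumes "b \<in> acl L as N"
  shows "finite {w. M \<in> tp_set L N (as @ [b]) (xs @ [w])}"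
    and "card {w. M \<in> tp_set L N (as @ [b]) (xs @ [w])} \<le> card {g b | g. g \<in> Aut_stabilizer L N as}"
proof -
  let ?W = "{w. M \<in> tp_set L N (as @ [b]) (xs @ [w])}" and ?O = "{g b | g. g \<in> Aut_stabilizer L N as}"
  have fin: "finite ?O" using assms by (simp add: acl_def)
  have "finite ?W \<and> card ?W \<le> card ?O"
  proof (cases "?W = {}")
    case False
    then obtain w0 h0 where h0: "isomorphism L M N h0" "map h0 xs = as"
      by (auto simp: tp_set_def)
    then have inj: "inj h0" by (simp add: isomorphism_def bij_is_inj)
    have "h0 ` ?W \<subseteq> ?O"
    proof
      fix c assume "c \<in> h0 ` ?W"
      then obtain w h where c: "c = h0 w" and h: "isomorphism L M N h" "map h xs = as" "h w = b"
        by (auto simp: tp_set_def)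
      have i: "inv h (h x) = x" for x using h(1) by (simp add: isomorphism_def bij_is_inj)
      have "isomorphism L N N (h0 \<circ> inv h)"
        by (rule isomorphism_comp[OF isomorphism_inv[OF h(1)] h0(1)])
      moreover have "(h0 \<circ> inv h) a = a" if a: "a \<in> set as" for a
      proof -
        obtain k where "k < length xs" "a = as ! k" using a h(2) by (metis in_set_conv_nth length_map)
        then have "a = h (xs ! k)" "a = h0 (xs ! k)" using h(2) h0(2) by auto
        then show ?thesis using i by simp
      qed
      ultimately have "h0 \<circ> inv h \<in> Aut_stabilizer L N as"
        by (simp add: Aut_stabilizer_def Aut_def)
      moreover have "c = (h0 \<circ> inv h) b" using c h(3) i by auto
      ultimately show "c \<in> ?O" by blast
    qed
    moreover have "inj_on h0 ?W" using inj by (rule inj_on_subset) simp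
    ultimately show ?thesis using fin by (meson card_inj_on_le finite_imageD finite_subset)
  qed simp
  then show "finite ?W" "card ?W \<le> card ?O" by auto
qed

text \<open>The sum of the probabilities is the expected number of events that occur.\<close>

lemma (in prob_space) sum_prob_le_multiplicity:
  assumes "finite W" "\<And>w. w \<in> W \<Longrightarrow> A w \<in> sets M"
    and "\<And>x. x \<in> space M \<Longrightarrow> card {w \<in> W. x \<in> A w} \<le> K"
  shows "(\<Sum>w\<in>W. prob (A w)) \<le> real K"
proof -
  have "(\<Sum>w\<in>W. prob (A w)) = (\<Sum>w\<in>W. \<integral>x. indicator (A w) x \<partial>M)"
    using assms(2) by (intro sum.cong) (auto simp: Int_absorb2 sets.sets_into_space)
  also have "\<dots> = (\<integral>x. (\<Sum>w\<in>W. indicator (A w) x) \<partial>M)"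
    using assms(2) by (intro Bochner_Integration.integral_sum[symmetric] integrable_real_indicator) (auto simp: emeasure_eq_measure)
  also have "\<dots> \<le> (\<integral>x. real K \<partial>M)"
  proof (rule integral_mono)
    show "integrable M (\<lambda>x. \<Sum>w\<in>W. indicator (A w) x :: real)"
      using assms(2) by (intro Bochner_Integration.integrable_sum integrable_real_indicator) (auto simp: emeasure_eq_measure)
    fix x assume x: "x \<in> space M"
    have "(\<Sum>w\<in>W. indicator (A w) x :: real) = real (card {w \<in> W. x \<in> A w})"
      using assms(1) by (simp add: indicator_def sum.If_cases Int_def)
    then show "(\<Sum>w\<in>W. indicator (A w) x) \<le> real K" using assms(3)[OF x] by simp
  qed simp
  also have "\<dots> = real K" by (simp add: prob_space)
  finally show ?thesis .
qed

text \<open>In the finite set \<open>X\<close> the complements of \<open>A\<close> and of its image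
  have equal size, so any bijection between them completes \<open>f\<close>.\<close>

lemma bij_betw_extend_finite:
  assumes X: "finite X" and A: "A \<subseteq> X" "inj_on f A" "f ` A \<subseteq> X"
  obtains g where "bij_betw g X X" "\<And>a. a \<in> A \<Longrightarrow> g a = f a"
proof -
  have fA: "bij_betw f A (f ` A)" using A(2) by (simp add: bij_betw_def)
  have "card (X - A) = card (X - f ` A)"
    using A X by (simp add: card_Diff_subset finite_subset card_image)
  then obtain k where k: "bij_betw k (X - A) (X - f ` A)"
    using X finite_same_card_bij[of "X - A" "X - f ` A"] by auto
  let ?g = "\<lambda>x. if x \<in> A then f x else k x"
  have "bij_betw ?g A (f ` A)" using fA by (rule bij_betw_cong[THEN iffD1, rotated]) simp
  moreover have "bij_betw ?g (X - A) (X - f ` A)" using k by (rule bij_betw_cong[THEN iffD1, rotated]) simp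
  ultimately have "bij_betw ?g (A \<union> (X - A)) (f ` A \<union> (X - f ` A))" by (rule bij_betw_combine) blast
  moreover have "A \<union> (X - A) = X" "f ` A \<union> (X - f ` A) = X" using A by auto
  ultimately show thesis by (intro that[of ?g]) auto
qed

text \<open>A Fubini formula for choice functions: the value at \<open>y\<close> is summed
  innermost, with all other choices frozen.\<close>

lemma sum_PiE_split:
  fixes f :: "('a \<Rightarrow> nat) \<Rightarrow> real"
  assumes "y \<in> S"
  shows "(\<Sum>c\<in>Pi\<^sub>E S (\<lambda>_. {..<n}). f c) = (\<Sum>c\<in>Pi\<^sub>E (S - {y}) (\<lambda>_. {..<n}). \<Sum>j<n. f (c(y := j)))"
proof -
  have S: "S = insert y (S - {y})" using assms by auto
  have inj: "inj_on (\<lambda>(j, c). c(y := j)) ({..<n} \<times> Pi\<^sub>E (S - {y}) (\<lambda>_. {..<n}))"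
    by (rule inj_combinator) simp
  have "(\<Sum>c\<in>Pi\<^sub>E S (\<lambda>_. {..<n}). f c) = (\<Sum>c\<in>(\<lambda>(j, c). c(y := j)) ` ({..<n} \<times> Pi\<^sub>E (S - {y}) (\<lambda>_. {..<n})). f c)"
    by (subst S, subst PiE_insert_eq) simp
  also have "\<dots> = (\<Sum>(j, c)\<in>{..<n} \<times> Pi\<^sub>E (S - {y}) (\<lambda>_. {..<n}). f (c(y := j)))"
    by (subst sum.reindex[OF inj]) (simp add: case_prod_beta o_def)
  also have "\<dots> = (\<Sum>j<n. \<Sum>c\<in>Pi\<^sub>E (S - {y}) (\<lambda>_. {..<n}). f (c(y := j)))"
    by (simp add: sum.cartesian_product)
  also have "\<dots> = (\<Sum>c\<in>Pi\<^sub>E (S - {y}) (\<lambda>_. {..<n}). \<Sum>j<n. f (c(y := j)))"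
    by (rule sum.swap)
  finally show ?thesis .
qed

text \<open>Every copy of \<open>N\<close> lies in one of countably many type events that exhibit an
  algebraic point off \<open>D\<close>. Continuity of the measure from below then leaves finitely
  many of them.\<close>

lemma finite_algebraic_cover:
  assumes L: "countable_language L" and N: "N \<in> Str L"
    and \<mu>: "borel_prob_measure L \<mu>" "emeasure \<mu> (iso_class L N) = 1"
    and alg: "highly_algebraic L N" and D: "finite D" and \<epsilon>: "\<epsilon> > 0"
  obtains Q where "finite Q"
    "\<And>as b xs y. (as, b, xs, y) \<in> Q \<Longrightarrow> y \<notin> D \<union> set xs \<and> b \<in> acl L as N"
    "measure \<mu> (\<Union>(as, b, xs, y)\<in>Q. tp_set L N (as @ [b]) (xs @ [y])) \<ge> 1 - \<epsilon>"
proof -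
  interpret prob_space \<mu> using \<mu> by (simp add: borel_prob_measure_def)
  have sets: "sets \<mu> = sets (Str_borel L)" using \<mu> by (simp add: borel_prob_measure_def)
  define T where "T = {(as, b, xs, y). y \<notin> D \<union> set xs \<and> b \<in> acl L as N}"
  define B where "B = (\<lambda>(as, b, xs, y). tp_set L N (as @ [b]) (xs @ [y]))"
  define A where "A n = (\<Union>q\<in>{q\<in>T. to_nat q < n}. B q)" for n
  have fin: "finite {q :: nat list \<times> nat \<times> nat list \<times> nat. to_nat q < n}" for n
    using finite_vimageI[OF finite_lessThan[of n] inj_to_nat] by (simp add: vimage_def)
  then have finT: "finite {q\<in>T. to_nat q < n}" for n by (rule finite_subset[rotated]) auto
  have Bm: "B q \<in> sets \<mu>" for q
    unfolding B_def sets by (auto simp: case_prod_beta intro!: tp_set_Borel L N)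
  have "range A \<subseteq> sets \<mu>" unfolding A_def using Bm finT by auto
  moreover have "incseq A" unfolding A_def by (fastforce simp: incseq_def)
  ultimately have lim: "(\<lambda>n. prob (A n)) \<longlonglongrightarrow> prob (\<Union>n. A n)"
    by (rule finite_Lim_measure_incseq)
  have "iso_class L N \<subseteq> (\<Union>n. A n)"
  proof
    fix M assume "M \<in> iso_class L N"
    then obtain h where M: "M \<in> Str L" and h: "isomorphism L M N h" by (auto simp: iso_class_def)
    then have bij: "bij h" by (simp add: isomorphism_def)
    \<comment> \<open>The finite set to be avoided in \<open>N\<close> is the image of
      \<open>D\<close> under \<open>h\<close>, so it depends on the copy; pulling back along
      \<open>h\<close> makes the avoided set \<open>D\<close> for all copies.\<close>
    obtain as b where b: "b \<in> acl L as N" "b \<notin> h ` D" "b \<notin> set as"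
      using alg D unfolding highly_algebraic_def by (metis UnCI finite_imageI subsetI)
    have i: "h (inv h x) = x" for x using bij by (simp add: bij_is_surj surj_f_inv_f)
    let ?q = "(as, b, map (inv h) as, inv h b)"
    have "?q \<in> T" unfolding T_def using b i by (auto simp: image_iff) (metis i)+
    moreover have "M \<in> B ?q" unfolding B_def tp_set_def using M h i by (auto simp: o_def intro!: exI[of _ h])
    ultimately have "M \<in> A (Suc (to_nat ?q))" unfolding A_def by blast
    then show "M \<in> (\<Union>n. A n)" by blast
  qed
  moreover have "(\<Union>n. A n) \<in> sets \<mu>" using \<open>range A \<subseteq> sets \<mu>\<close> by blast
  ultimately have "1 \<le> prob (\<Union>n. A n)"
    using \<mu>(2) by (metis emeasure_eq_measure ennreal_eq_1 finite_measure_mono)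
  then have "1 - \<epsilon> < prob (\<Union>n. A n)" using \<epsilon> by linarith
  from order_tendstoD(1)[OF lim this] obtain n where n: "1 - \<epsilon> < prob (A n)"
    unfolding eventually_sequentially by blast
  show thesis
  proof (rule that[OF finT[of n]])
    show "y \<notin> D \<union> set xs \<and> b \<in> acl L as N" if "(as, b, xs, y) \<in> {q\<in>T. to_nat q < n}" for as b xs y
      using that by (simp add: T_def)
    show "1 - \<epsilon> \<le> prob (\<Union>(as, b, xs, y)\<in>{q\<in>T. to_nat q < n}. tp_set L N (as @ [b]) (xs @ [y]))"
      using n unfolding A_def B_def by simp
  qed
qed

text \<open>Fresh values for the points outside \<open>D\<close> are chosen at random from disjoint blocks of length \<open>n\<close>:
  the image of an algebraic point is right with probability at most (orbit size) / \<open>n\<close>.\<close>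

lemma permutation_step:
  assumes L: "countable_language L" and N: "N \<in> Str L"
    and \<mu>: "borel_prob_measure L \<mu>" "emeasure \<mu> (iso_class L N) = 1"
    and alg: "highly_algebraic L N" and D: "finite D" "bij_betw \<gamma> D D" and \<epsilon>: "\<epsilon> > 0"
  obtains D' \<gamma>' E where "finite D'" "insert m D \<subseteq> D'" "bij_betw \<gamma>' D' D'" "\<And>d. d \<in> D \<Longrightarrow> \<gamma>' d = \<gamma> d"
    "E \<in> sets (Str_borel L)" "measure \<mu> E \<ge> 1 - \<epsilon>"
    "\<And>g. bij g \<Longrightarrow> (\<And>d. d \<in> D' \<Longrightarrow> g d = \<gamma>' d) \<Longrightarrow> measure \<mu> (logic_action L g ` E) \<le> \<epsilon>"
proof -
  interpret prob_space \<mu> using \<mu> by (simp add: borel_prob_measure_def)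
  have sets: "sets \<mu> = sets (Str_borel L)" using \<mu> by (simp add: borel_prob_measure_def)
  obtain Q where Q: "finite Q"
    "\<And>as b xs y. (as, b, xs, y) \<in> Q \<Longrightarrow> y \<notin> D \<union> set xs \<and> b \<in> acl L as N"
    "measure \<mu> (\<Union>(as, b, xs, y)\<in>Q. tp_set L N (as @ [b]) (xs @ [y])) \<ge> 1 - \<epsilon>"
    by (rule finite_algebraic_cover[OF L N \<mu> alg D(1) \<epsilon>]) blast
  define tp where "tp v = (\<lambda>(as, b, xs, y). tp_set L N (as @ [b]) (map v xs @ [v y]))" for v :: "nat \<Rightarrow> nat"
  define k where "k = (\<lambda>(as, b, xs :: nat list, y :: nat). card {g b | g. g \<in> Aut_stabilizer L N as})"
  \<comment> \<open>The points mentioned by \<open>Q\<close> whose images are not yet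
    prescribed.\<close>
  define S where "S = (\<Union>(as, b, xs, y)\<in>Q. insert y (set xs)) - D"
  have finS: "finite S" unfolding S_def using Q(1) by auto
  define K where "K = (\<Sum>q\<in>Q. real (k q))"
  have tpm: "tp v q \<in> sets \<mu>" for v q
    unfolding tp_def sets by (auto simp: case_prod_beta intro!: tp_set_Borel L N)
  \<comment> \<open>Beyond \<open>off\<close> fresh values cannot collide with the values of
    \<open>\<gamma>\<close>, which lie in \<open>D\<close>.\<close>
  obtain off where off: "\<And>d. d \<in> D \<Longrightarrow> d < off"
    using finite_nat_bounded[OF D(1)] by auto
  obtain n :: nat where n: "K / \<epsilon> < real n" using reals_Archimedean2 by blast
  have "K \<ge> 0" by (simp add: K_def sum_nonneg)
  then have "real n > 0" using n \<epsilon> by (meson divide_nonneg_pos le_less_trans)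
  then have n0: "n > 0" by simp
  have Kn: "K \<le> \<epsilon> * real n" using n \<epsilon> by (simp add: field_simps)
  \<comment> \<open>Each \<open>s\<close> outside \<open>D\<close> owns the block of length
    \<open>n\<close> starting at \<open>off + s * n\<close>, and \<open>c\<close> selects a place in
    it. Disjointness of the blocks makes \<open>v c\<close> injective on \<open>D \<union> S\<close>
    for every admissible \<open>c\<close>.\<close>
  define v where "v c s = (if s \<in> D then \<gamma> s else off + s * n + c s)" for c :: "nat \<Rightarrow> nat" and s
  let ?C = "\<lambda>S. Pi\<^sub>E S (\<lambda>_. {..<n})"
  \<comment> \<open>As \<open>y\<close> is neither in \<open>D\<close> nor in \<open>xs\<close>,
    varying \<open>c y\<close> alone changes only the last entry. The \<open>n\<close> resulting
    events overlap at most \<open>k q\<close> times, so their probabilities sum to at most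
    \<open>k q\<close>.\<close>
  have one: "(\<Sum>c\<in>?C S. prob (tp (v c) q)) * real n \<le> real (k q) * real n ^ card S" if q: "q \<in> Q" for q
  proof -
    obtain as b xs y where qe: "q = (as, b, xs, y)" by (metis prod_cases4)
    then have y: "y \<notin> D" "y \<notin> set xs" "b \<in> acl L as N" using Q(2) q by auto
    then have yS: "y \<in> S" unfolding S_def using q qe by force
    have "(\<Sum>c\<in>?C S. prob (tp (v c) q)) = (\<Sum>c\<in>?C (S - {y}). \<Sum>j<n. prob (tp (v (c(y := j))) q))"
      by (rule sum_PiE_split[OF yS])
    also have "\<dots> \<le> (\<Sum>c\<in>?C (S - {y}). real (k q))"
    proof (rule sum_mono)
      fix c
      have "tp (v (c(y := j))) q = tp_set L N (as @ [b]) (map (v c) xs @ [off + y * n + j])" for j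
      proof -
        have "map (v (c(y := j))) xs = map (v c) xs" using y(2) by (auto simp: v_def)
        moreover have "v (c(y := j)) y = off + y * n + j" using y(1) by (simp add: v_def)
        ultimately show ?thesis unfolding tp_def qe prod.case by (simp only:)
      qed
      then have "(\<Sum>j<n. prob (tp (v (c(y := j))) q)) =
          (\<Sum>j<n. prob (tp_set L N (as @ [b]) (map (v c) xs @ [off + y * n + j])))" by simp
      also have "\<dots> \<le> real (k q)"
      proof (rule sum_prob_le_multiplicity)
        show "tp_set L N (as @ [b]) (map (v c) xs @ [off + y * n + j]) \<in> events" for j
          unfolding sets by (intro tp_set_Borel L N)
        fix M
        let ?W = "{w. M \<in> tp_set L N (as @ [b]) (map (v c) xs @ [w])}"
        have "card {j \<in> {..<n}. M \<in> tp_set L N (as @ [b]) (map (v c) xs @ [off + y * n + j])} \<le> card ?W"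
          by (rule card_inj_on_le[where f = "\<lambda>j. off + y * n + j"])
             (use card_tp_set_fiber(1)[OF y(3)] in \<open>auto simp: inj_on_def\<close>)
        also have "\<dots> \<le> k q" using card_tp_set_fiber(2)[OF y(3)] by (simp add: k_def qe)
        finally show "card {j \<in> {..<n}. M \<in> tp_set L N (as @ [b]) (map (v c) xs @ [off + y * n + j])} \<le> k q" .
      qed simp
      finally show "(\<Sum>j<n. prob (tp (v (c(y := j))) q)) \<le> real (k q)" .
    qed
    also have "\<dots> = real n ^ card (S - {y}) * real (k q)"
      using finS by (simp add: card_PiE)
    finally have "(\<Sum>c\<in>?C S. prob (tp (v c) q)) * real n \<le> real n ^ card (S - {y}) * real (k q) * real n"
      by (intro mult_right_mono) auto
    also have "\<dots> = real (k q) * real n ^ Suc (card (S - {y}))" by simp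
    also have "Suc (card (S - {y})) = card S" using finS yS by (rule card_Suc_Diff1)
    finally show ?thesis .
  qed
  \<comment> \<open>An averaging argument: over all choices \<open>c\<close> the mean of this sum is
    at most \<open>K / n\<close>, hence at most \<open>\<epsilon>\<close>.\<close>
  have "\<exists>c\<in>?C S. (\<Sum>q\<in>Q. prob (tp (v c) q)) \<le> \<epsilon>"
  proof (rule ccontr)
    assume "\<not> ?thesis"
    then have less: "\<epsilon> < (\<Sum>q\<in>Q. prob (tp (v c) q))" if "c \<in> ?C S" for c using that by force
    have cardC: "card (?C S) = n ^ card S" using finS by (simp add: card_PiE)
    have ne: "?C S \<noteq> {}" using n0 by (auto simp: PiE_eq_empty_iff)
    have "(\<Sum>c\<in>?C S. \<epsilon>) < (\<Sum>c\<in>?C S. \<Sum>q\<in>Q. prob (tp (v c) q))"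
      using less ne finS by (intro sum_strict_mono finite_PiE) auto
    then have "\<epsilon> * real n ^ card S < (\<Sum>c\<in>?C S. \<Sum>q\<in>Q. prob (tp (v c) q))"
      using cardC by (simp add: mult.commute)
    then have "\<epsilon> * real n ^ card S * real n < (\<Sum>c\<in>?C S. \<Sum>q\<in>Q. prob (tp (v c) q)) * real n"
      using n0 by (intro mult_strict_right_mono) auto
    also have "\<dots> = (\<Sum>q\<in>Q. (\<Sum>c\<in>?C S. prob (tp (v c) q)) * real n)"
      by (subst sum.swap) (simp add: sum_distrib_right)
    also have "\<dots> \<le> (\<Sum>q\<in>Q. real (k q) * real n ^ card S)" by (rule sum_mono[OF one])
    also have "\<dots> = K * real n ^ card S" by (simp add: K_def sum_distrib_right)
    also have "\<dots> \<le> \<epsilon> * real n * real n ^ card S" using Kn by (intro mult_right_mono) auto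
    finally show False by (simp add: mult_ac)
  qed
  then obtain c where c: "c \<in> ?C S" "(\<Sum>q\<in>Q. prob (tp (v c) q)) \<le> \<epsilon>" by blast
  let ?v = "v c"
  have vD: "?v d = \<gamma> d" "?v d < off" if "d \<in> D" for d
    using that D(2) off by (auto simp: v_def bij_betw_def)
  have vS: "?v s \<ge> off" "(?v s - off) div n = s" if "s \<in> S" for s
    using that c(1) n0 by (auto simp: v_def S_def PiE_iff)
  have inj: "inj_on ?v (D \<union> S)"
  proof (rule inj_onI)
    fix s t assume st: "s \<in> D \<union> S" "t \<in> D \<union> S" "?v s = ?v t"
    consider "s \<in> D" "t \<in> D" | "s \<in> S" "t \<in> S" | "s \<in> D" "t \<in> S" | "s \<in> S" "t \<in> D" using st by blast
    then show "s = t"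
    proof cases
      case 1
      then show ?thesis using st(3) vD(1) D(2) by (metis bij_betw_def inj_onD)
    next
      case 2
      then show ?thesis using st(3) vS(2) by metis
    qed (use st(3) vD(2) vS(1) in fastforce)+
  qed
  \<comment> \<open>Adding \<open>m\<close> lets the successive domains exhaust the natural numbers;
    adding the images lets the injection be completed to a permutation of \<open>D'\<close>.\<close>
  define D' where "D' = insert m (D \<union> S \<union> ?v ` (D \<union> S))"
  have finD': "finite D'" unfolding D'_def using D finS by auto
  obtain \<gamma>' where \<gamma>': "bij_betw \<gamma>' D' D'" "\<And>d. d \<in> D \<union> S \<Longrightarrow> \<gamma>' d = ?v d"
    by (rule bij_betw_extend_finite[OF finD' _ inj]) (auto simp: D'_def)
  define E where "E = (\<Union>(as, b, xs, y)\<in>Q. tp_set L N (as @ [b]) (xs @ [y]))"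
  show thesis
  proof (rule that[OF finD' _ \<gamma>'(1)])
    show "insert m D \<subseteq> D'" by (auto simp: D'_def)
    show "\<gamma>' d = \<gamma> d" if "d \<in> D" for d using \<gamma>'(2) vD that by simp
    show "E \<in> sets (Str_borel L)"
      unfolding E_def using Q(1) by (auto intro!: sets.finite_UN tp_set_Borel L N)
    show "1 - \<epsilon> \<le> prob E" using Q(3) by (simp add: E_def)
    fix g assume g: "bij g" "\<And>d. d \<in> D' \<Longrightarrow> g d = \<gamma>' d"
    have gv: "g d = ?v d" if "d \<in> D \<union> S" for d using g(2)[of d] \<gamma>'(2)[of d] that by (auto simp: D'_def)
    have "logic_action L g ` E \<subseteq> (\<Union>q\<in>Q. tp ?v q)"
    proof -
      have "logic_action L g ` tp_set L N (as @ [b]) (xs @ [y]) \<subseteq> tp ?v (as, b, xs, y)"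
        if "(as, b, xs, y) \<in> Q" for as b xs y
      proof -
        have "set xs \<subseteq> D \<union> S" "y \<in> D \<union> S" unfolding S_def using that by force+
        then have "map g (xs @ [y]) = map ?v xs @ [?v y]" using gv by auto
        then show ?thesis using logic_action_tp_set[OF g(1), of L N "as @ [b]" "xs @ [y]"]
          unfolding tp_def prod.case by (simp only:)
      qed
      then show ?thesis
        unfolding E_def image_UN by (intro UN_mono subset_refl) (simp only: split: prod.split, blast)
    qed
    then have "prob (logic_action L g ` E) \<le> prob (\<Union>q\<in>Q. tp ?v q)"
      using tpm Q(1) by (intro finite_measure_mono sets.finite_UN) auto
    also have "\<dots> \<le> (\<Sum>q\<in>Q. prob (tp ?v q))"
      using tpm Q(1) by (intro finite_measure_subadditive_finite) auto
    also have "\<dots> \<le> \<epsilon>" by (rule c(2))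
    finally show "prob (logic_action L g ` E) \<le> \<epsilon>" .
  qed
qed

text \<open>The errors \<open>?e n\<close> sum to 1/2, so the intersection of the sets
  \<open>E n\<close> has measure at least 1/2. Its image under the limit permutation lies in the
  image of every \<open>E n\<close>, so it is null.\<close>

theorem not_quasi_random_if_highly_algebraic:
  assumes L: "countable_language L" and N: "N \<in> Str L" and alg: "highly_algebraic L N"
  shows "\<not> quasi_random L N"
proof
  assume "quasi_random L N"
  then obtain \<mu> where \<mu>: "borel_prob_measure L \<mu>" "emeasure \<mu> (iso_class L N) = 1"
    and qi: "quasi_invariant L \<mu>" by (auto simp: quasi_random_def)
  interpret prob_space \<mu> using \<mu> by (simp add: borel_prob_measure_def)
  have sets: "sets \<mu> = sets (Str_borel L)" using \<mu> by (simp add: borel_prob_measure_def)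
  let ?e = "\<lambda>n. (1 / 2) ^ (n + 2) :: real"
  let ?P = "\<lambda>n p. finite (fst p) \<and> bij_betw (snd p) (fst p) (fst p)"
  let ?R = "\<lambda>n p q E. insert n (fst p) \<subseteq> fst q \<and> (\<forall>d\<in>fst p. snd q d = snd p d) \<and> E \<in> sets (Str_borel L) \<and>
      prob E \<ge> 1 - ?e n \<and> (\<forall>g. bij g \<longrightarrow> (\<forall>d\<in>fst q. g d = snd q d) \<longrightarrow> prob (logic_action L g ` E) \<le> ?e n)"
  let ?Q = "\<lambda>n p q. \<exists>E. ?R n p q E"
  have "\<exists>s :: nat \<Rightarrow> nat set \<times> (nat \<Rightarrow> nat). \<forall>n. ?P n (s n) \<and> ?Q n (s n) (s (Suc n))"
  proof (rule dependent_nat_choice)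
    show "\<exists>p. ?P 0 p" by (intro exI[of _ "({}, id)"]) simp
    fix p :: "nat set \<times> (nat \<Rightarrow> nat)" and n assume "?P n p"
    then have p: "finite (fst p)" "bij_betw (snd p) (fst p) (fst p)" by auto
    show "\<exists>q. ?P (Suc n) q \<and> ?Q n p q"
    proof (rule permutation_step[OF L N \<mu> alg p, of "?e n" n])
      fix D' \<gamma>' E
      assume "finite D'" "insert n (fst p) \<subseteq> D'" "bij_betw \<gamma>' D' D'" "\<And>d. d \<in> fst p \<Longrightarrow> \<gamma>' d = snd p d"
        "E \<in> sets (Str_borel L)" "measure \<mu> E \<ge> 1 - ?e n"
        "\<And>g. bij g \<Longrightarrow> (\<And>d. d \<in> D' \<Longrightarrow> g d = \<gamma>' d) \<Longrightarrow> measure \<mu> (logic_action L g ` E) \<le> ?e n"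
      then show "\<exists>q. ?P (Suc n) q \<and> ?Q n p q"
        by (intro exI[of _ "(D', \<gamma>')"] conjI exI[of _ E]) auto
    qed simp
  qed
  then obtain s :: "nat \<Rightarrow> nat set \<times> (nat \<Rightarrow> nat)" where s: "\<And>n. ?P n (s n)" "\<And>n. ?Q n (s n) (s (Suc n))"
    by blast
  then obtain E where E: "\<And>n. ?R n (s n) (s (Suc n)) (E n)" by metis
  define D where "D n = fst (s n)" for n
  define \<gamma> where "\<gamma> n = snd (s n)" for n
  have bij: "bij_betw (\<gamma> n) (D n) (D n)" for n using s(1)[of n] by (simp add: D_def \<gamma>_def)
  have DS: "insert n (D n) \<subseteq> D (Suc n)" "\<And>d. d \<in> D n \<Longrightarrow> \<gamma> (Suc n) d = \<gamma> n d" for n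
    using E[of n] by (auto simp: D_def \<gamma>_def)
  have mono: "mono D" unfolding mono_iff_le_Suc using DS by blast
  have \<gamma>_mono: "\<gamma> m d = \<gamma> n d" if "n \<le> m" "d \<in> D n" for n m d
    using that
  proof (induction m rule: dec_induct)
    case (step m)
    then have "d \<in> D m" using monoD[OF mono] by blast
    then show ?case using DS(2) step by simp
  qed simp
  \<comment> \<open>Stage \<open>Suc d\<close> is the first at which \<open>d\<close> is guaranteed
    to be in the domain; later stages do not change the value there.\<close>
  define g where "g d = \<gamma> (Suc d) d" for d
  have g: "g d = \<gamma> n d" if "d \<in> D n" for d n
    using \<gamma>_mono[of "Suc d" "max n (Suc d)" d] \<gamma>_mono[of n "max n (Suc d)" d] that DS(1)[of d]
    by (simp add: g_def)
  have "bij g"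
  proof (rule bijI)
    show "inj g"
    proof (rule injI)
      fix a b assume ab: "g a = g b"
      let ?n = "Suc (max a b)"
      have "a \<in> D ?n" "b \<in> D ?n"
        using DS(1)[of a] DS(1)[of b] monoD[OF mono, of "Suc a" ?n] monoD[OF mono, of "Suc b" ?n] by auto
      then show "a = b" using ab bij[of ?n] g by (metis bij_betw_def inj_onD)
    qed
    show "surj g"
      unfolding surj_def
    proof
      fix b
      \<comment> \<open>Surjectivity of the limit is the reason why each stage is a permutation of
        its finite domain and not merely an injection.\<close>
      have "b \<in> D (Suc b)" using DS(1) by blast
      then obtain a where "a \<in> D (Suc b)" "\<gamma> (Suc b) a = b"
        using bij[of "Suc b"] by (metis bij_betw_def imageE)
      then show "\<exists>a. b = g a" using g by metis
    qed
  qed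
  have Em: "E n \<in> events" for n using E[of n] sets by simp
  let ?I = "\<Inter>n. E n"
  have "prob (space \<mu> - ?I) \<le> 1 / 2"
  proof -
    have "space \<mu> - ?I = (\<Union>n. space \<mu> - E n)" by auto
    moreover have "prob (\<Union>n. space \<mu> - E n) \<le> (\<Sum>n. prob (space \<mu> - E n))"
    proof (rule finite_measure_subadditive_countably)
      show "summable (\<lambda>n. prob (space \<mu> - E n))"
      proof (rule summable_comparison_test')
        show "summable (\<lambda>n. ?e n)" by (simp add: summable_geometric)
        show "norm (prob (space \<mu> - E n)) \<le> ?e n" if "n \<ge> 0" for n
          using E[of n] Em[of n] by (simp add: prob_compl)
      qed
    qed (use Em in auto)
    moreover have "(\<Sum>n. prob (space \<mu> - E n)) \<le> (\<Sum>n. ?e n)"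
    proof (rule suminf_le)
      show le: "prob (space \<mu> - E n) \<le> ?e n" for n using E[of n] Em[of n] by (simp add: prob_compl)
      show "summable (\<lambda>n. ?e n)" by (simp add: summable_geometric)
      then show "summable (\<lambda>n. prob (space \<mu> - E n))"
        by (rule summable_comparison_test'[where N = 0]) (use le in simp)
    qed
    moreover have "(\<Sum>n. ?e n) = 1 / 2"
    proof -
      have "(\<lambda>n. (1 / 4) * (1 / 2) ^ n :: real) sums ((1 / 4) * (1 / (1 - 1 / 2)))"
        by (intro sums_mult geometric_sums) simp
      then show ?thesis by (simp add: sums_iff power_add mult.commute)
    qed
    ultimately show ?thesis by simp
  qed
  moreover have Im: "?I \<in> events" using Em by blast
  ultimately have "prob ?I \<ge> 1 / 2" by (simp add: prob_compl)
  then have "emeasure \<mu> ?I \<noteq> 0" by (auto simp: emeasure_eq_measure)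
  moreover have "prob (logic_action L g ` ?I) \<le> ?e n" for n
  proof -
    have En: "E n \<subseteq> Str L" using Em[of n] sets.sets_into_space[of "E n" "Str_borel L"] sets by (simp add: space_Str_borel)
    have "logic_action L g ` E n = logic_action L (inv g) -` E n \<inter> space (Str_borel L)"
      using logic_action_image[OF \<open>bij g\<close> En] by (simp add: space_Str_borel)
    then have "logic_action L g ` E n \<in> events"
      using measurable_sets[OF measurable_logic_action[OF L bij_imp_bij_inv[OF \<open>bij g\<close>]], of "E n"] Em[of n] sets by simp
    then have "prob (logic_action L g ` ?I) \<le> prob (logic_action L g ` E n)"
      by (intro finite_measure_mono) auto
    also have "\<dots> \<le> ?e n" using E[of n] \<open>bij g\<close> g by (auto simp: D_def \<gamma>_def)
    finally show ?thesis .
  qed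
  moreover have "(\<lambda>n. ?e n) \<longlonglongrightarrow> 0"
    by (intro LIMSEQ_ignore_initial_segment LIMSEQ_power_zero) simp
  ultimately have "prob (logic_action L g ` ?I) \<le> 0"
    by (intro LIMSEQ_le_const[of ?e 0]) blast+
  then have "emeasure \<mu> (logic_action L g ` ?I) = 0"
    by (simp add: emeasure_eq_measure measure_le_0_iff)
  moreover have "?I \<in> sets (Str_borel L)" using Im sets by simp
  ultimately show False
    using qi \<open>bij g\<close> \<open>emeasure \<mu> ?I \<noteq> 0\<close> unfolding quasi_invariant_def by blast
qed

section \<open>Moving finite sets along infinite orbits\<close>

text \<open>An abstraction of the pointwise stabilizer of \<open>F\<close> in the automorphism
  group. The last assumption is what remains of the failure of high algebraicity.\<close>

locale infinite_orbits =
  fixes G :: "(nat \<Rightarrow> nat) set" and F :: "nat set"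
  assumes finite_F: "finite F"
    and id_G: "id \<in> G"
    and comp_G: "g \<in> G \<Longrightarrow> h \<in> G \<Longrightarrow> g \<circ> h \<in> G"
    and inv_G: "g \<in> G \<Longrightarrow> inv g \<in> G"
    and bij_G: "g \<in> G \<Longrightarrow> bij g"
    and fix_F: "g \<in> G \<Longrightarrow> a \<in> F \<Longrightarrow> g a = a"
    and infinite_orbit: "finite B \<Longrightarrow> b \<notin> F \<union> B \<Longrightarrow> infinite {g b | g. g \<in> G \<and> (\<forall>a\<in>B. g a = a)}"
begin

lemma G_inverse: "g \<in> G \<Longrightarrow> inv g (g a) = a" "g \<in> G \<Longrightarrow> g (inv g a) = a"
  using bij_G by (auto simp: bij_is_inj bij_is_surj surj_f_inv_f)

text \<open>\<open>d\<close> is built one point at a time: moving \<open>b\<close> while fixing the other points of \<open>A\<close> and the values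
  chosen so far keeps all \<open>2 ^ card A\<close> patterns in one orbit.\<close>

lemma independent_moves:
  assumes A: "finite A" "A \<inter> F = {}"
  obtains d where "inj_on d A" "d ` A \<inter> (A \<union> F) = {}"
    "\<And>c. \<exists>g\<in>G. \<forall>a\<in>A. g a = (if c a then d a else a)"
proof -
  have "\<exists>d. inj_on d B \<and> d ` B \<inter> (A \<union> F) = {} \<and>
      (\<forall>c. \<exists>g\<in>G. \<forall>a\<in>A. g a = (if a \<in> B \<and> c a then d a else a))" if "B \<subseteq> A" for B
    using finite_subset[OF that A(1)] that
  proof (induction B rule: finite_induct)
    case empty
    then show ?case using id_G by (auto intro!: bexI[of _ id])
  next
    case (insert b B)
    have "B \<subseteq> A" using insert.prems by simp
    from insert.IH[OF this] obtain d where "inj_on d B \<and> d ` B \<inter> (A \<union> F) = {} \<and>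
      (\<forall>c. \<exists>g\<in>G. \<forall>a\<in>A. g a = (if a \<in> B \<and> c a then d a else a))" ..
    then have d: "inj_on d B" "d ` B \<inter> (A \<union> F) = {}"
      "\<And>c. \<exists>g\<in>G. \<forall>a\<in>A. g a = (if a \<in> B \<and> c a then d a else a)" by simp_all
    \<comment> \<open>An element \<open>h\<close> fixing \<open>?fix\<close> disturbs neither the
      other points of \<open>A\<close> nor the targets already chosen. As \<open>b\<close> is not in
      \<open>B\<close>, the earlier \<open>g\<close> leaves \<open>b\<close> in place, and
      \<open>h \<circ> g\<close> moves it in addition.\<close>
    let ?fix = "(A - {b}) \<union> d ` B" and ?avoid = "A \<union> F \<union> d ` B"
    have "b \<notin> F \<union> ?fix" using A(2) insert.prems d(2) by blast
    then have "infinite {g b | g. g \<in> G \<and> (\<forall>a\<in>?fix. g a = a)}"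
      using A(1) insert.hyps(1) by (intro infinite_orbit) simp
    moreover have "finite ?avoid" using A(1) finite_F insert.hyps(1) by simp
    ultimately have "\<not> {g b | g. g \<in> G \<and> (\<forall>a\<in>?fix. g a = a)} \<subseteq> ?avoid"
      using finite_subset by blast
    then obtain h where h: "h \<in> G" "\<And>a. a \<in> ?fix \<Longrightarrow> h a = a" "h b \<notin> ?avoid" by blast
    show ?case
    proof (intro exI[of _ "d(b := h b)"] conjI allI)
      show "inj_on (d(b := h b)) (insert b B)"
      proof -
        have "(d(b := h b)) ` (B - {b}) = d ` B" using insert.hyps(2) by auto
        then show ?thesis using d(1) h(3) by (simp add: inj_on_insert inj_on_fun_updI)
      qed
      show "(d(b := h b)) ` insert b B \<inter> (A \<union> F) = {}"
        using d(2) h(3) insert(2) by auto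
      fix c
      obtain g where g: "g \<in> G" "\<And>a. a \<in> A \<Longrightarrow> g a = (if a \<in> B \<and> c a then d a else a)" using d(3) by blast
      show "\<exists>g\<in>G. \<forall>a\<in>A. g a = (if a \<in> insert b B \<and> c a then (d(b := h b)) a else a)"
      proof (cases "c b")
        case False
        then show ?thesis using g insert(2) by (intro bexI[of _ g]) auto
      next
        case True
        show ?thesis
        proof (intro bexI[of _ "h \<circ> g"] ballI)
          fix a assume a: "a \<in> A"
          show "(h \<circ> g) a = (if a \<in> insert b B \<and> c a then (d(b := h b)) a else a)"
            using g(2)[OF a] h(2) True insert(2) a by auto
        qed (rule comp_G[OF h(1) g(1)])
      qed
    qed
  qed
  from this[OF subset_refl] obtain d where d: "inj_on d A" "d ` A \<inter> (A \<union> F) = {}"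
      "\<forall>c. \<exists>g\<in>G. \<forall>a\<in>A. g a = (if a \<in> A \<and> c a then d a else a)"
    by blast
  have "\<exists>g\<in>G. \<forall>a\<in>A. g a = (if c a then d a else a)" for c
  proof -
    obtain g where "g \<in> G" "\<And>a. a \<in> A \<Longrightarrow> g a = (if a \<in> A \<and> c a then d a else a)" using d(3) by blast
    then show ?thesis by (intro bexI[of _ g]) auto
  qed
  then show thesis by (rule that[OF d(1,2)])
qed

text \<open>Only the image tuple of \<open>as\<close> matters, not \<open>g\<close>, and finitely
  many such tuples lie in \<open>B \<union> F\<close>. For each of them the infinite orbit of
  \<open>c\<close> over \<open>as\<close> offers an image of \<open>c\<close> outside
  \<open>B \<union> F\<close>; \<open>W\<close> collects one per tuple.\<close>

lemma fresh_extensions: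
  assumes B: "finite B" and c: "c \<notin> F \<union> set as"
  obtains W where "finite W" "W \<inter> (B \<union> F) = {}"
    "\<And>g. g \<in> G \<Longrightarrow> set (map g as) \<subseteq> B \<union> F \<Longrightarrow> \<exists>g'\<in>G. map g' as = map g as \<and> g' c \<in> W"
proof -
  let ?T = "{ss. set ss \<subseteq> B \<union> F \<and> length ss = length as \<and> (\<exists>g\<in>G. map g as = ss)}"
  have finT: "finite ?T"
    by (rule finite_subset[OF _ finite_lists_length_eq[of "B \<union> F" "length as"]]) (use B finite_F in auto)
  have "\<forall>ss\<in>?T. \<exists>w. w \<notin> B \<union> F \<and> (\<exists>g'\<in>G. map g' as = ss \<and> g' c = w)"
  proof
    fix ss assume "ss \<in> ?T"
    then obtain g where g: "g \<in> G" "map g as = ss" by blast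
    let ?O = "{h c | h. h \<in> G \<and> (\<forall>a\<in>set as. h a = a)}"
    have "infinite ?O" using c by (intro infinite_orbit) auto
    then have "infinite (g ` ?O)"
      using bij_G[OF g(1)] by (subst finite_image_iff) (auto simp: bij_def intro: inj_on_subset)
    then have "\<not> g ` ?O \<subseteq> B \<union> F" using B finite_F by (meson finite_UnI finite_subset)
    then obtain h where h: "h \<in> G" "\<forall>a\<in>set as. h a = a" "g (h c) \<notin> B \<union> F" by blast
    then show "\<exists>w. w \<notin> B \<union> F \<and> (\<exists>g'\<in>G. map g' as = ss \<and> g' c = w)"
      using g by (intro exI[of _ "g (h c)"] conjI bexI[of _ "g \<circ> h"] comp_G) auto
  qed
  from bchoice[OF this] obtain w where w: "\<forall>ss\<in>?T. w ss \<notin> B \<union> F \<and> (\<exists>g'\<in>G. map g' as = ss \<and> g' c = w ss)" ..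
  show thesis
  proof (rule that[of "w ` ?T"])
    fix g assume g: "g \<in> G" "set (map g as) \<subseteq> B \<union> F"
    then have "map g as \<in> ?T" by auto
    then show "\<exists>g'\<in>G. map g' as = map g as \<and> g' c \<in> w ` ?T" using w by blast
  qed (use finT w in auto)
qed

text \<open>Stage \<open>n\<close> adds the targets of the move, the number \<open>n\<close> unless
  it is in \<open>F\<close>, and fresh values answering the back-and-forth demand
  \<open>task n\<close>. The fresh values avoid \<open>A n\<close>, so a particle that starts on one
  of them has not yet moved at time \<open>Suc n\<close>.\<close>

lemma exhaustion:
  fixes task :: "nat \<Rightarrow> nat list \<times> nat"
  obtains A d where "\<And>n. finite (A n)" "\<And>n. A n \<inter> F = {}" "\<And>n. A n \<subseteq> A (Suc n)" "\<And>n. n \<notin> F \<Longrightarrow> n \<in> A (Suc n)"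
    "\<And>n. d n ` A n \<subseteq> A (Suc n)" "\<And>n. inj_on (d n) (A n)" "\<And>n. d n ` A n \<inter> A n = {}"
    "\<And>n c. \<exists>g\<in>G. \<forall>a\<in>A n. g a = (if c a then d n a else a)"
    "\<And>n as c g. task n = (as, c) \<Longrightarrow> c \<notin> F \<union> set as \<Longrightarrow> g \<in> G \<Longrightarrow> set (map g as) \<subseteq> A n \<union> d n ` A n \<union> F \<Longrightarrow>
       \<exists>g'\<in>G. map g' as = map g as \<and> g' c \<in> A (Suc n) - A n"
proof -
  let ?R = "\<lambda>n A A' d. A \<subseteq> A' \<and> (n \<notin> F \<longrightarrow> n \<in> A') \<and> d ` A \<subseteq> A' \<and> inj_on d A \<and> d ` A \<inter> A = {} \<and>
     (\<forall>c. \<exists>g\<in>G. \<forall>a\<in>A. g a = (if c a then d a else a)) \<and>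
     (\<forall>as c g. task n = (as, c) \<longrightarrow> c \<notin> F \<union> set as \<longrightarrow> g \<in> G \<longrightarrow> set (map g as) \<subseteq> A \<union> d ` A \<union> F \<longrightarrow>
       (\<exists>g'\<in>G. map g' as = map g as \<and> g' c \<in> A' - A))"
  have "\<exists>A. \<forall>n. (finite (A n) \<and> A n \<inter> F = {}) \<and> (\<exists>d. ?R n (A n) (A (Suc n)) d)"
  proof (rule dependent_nat_choice)
    show "\<exists>A. finite A \<and> A \<inter> F = {}" by (rule exI[of _ "{}"]) simp
    fix A n assume A: "finite A \<and> A \<inter> F = {}"
    then obtain d where d: "inj_on d A" "d ` A \<inter> (A \<union> F) = {}"
      "\<And>c. \<exists>g\<in>G. \<forall>a\<in>A. g a = (if c a then d a else a)" using independent_moves by blast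
    obtain as c where t: "task n = (as, c)" by (cases "task n")
    let ?B = "A \<union> d ` A"
    have "\<exists>W. finite W \<and> W \<inter> (?B \<union> F) = {} \<and> (c \<notin> F \<union> set as \<longrightarrow>
      (\<forall>g. g \<in> G \<longrightarrow> set (map g as) \<subseteq> ?B \<union> F \<longrightarrow> (\<exists>g'\<in>G. map g' as = map g as \<and> g' c \<in> W)))"
    proof (cases "c \<notin> F \<union> set as")
      case True
      have "finite ?B" using A by simp
      then show ?thesis by (rule fresh_extensions[OF _ True]) blast
    next
      case False
      then show ?thesis by (intro exI[of _ "{}"]) simp
    qed
    then obtain W where W: "finite W" "W \<inter> (?B \<union> F) = {}"
       "\<And>g. c \<notin> F \<union> set as \<Longrightarrow> g \<in> G \<Longrightarrow> set (map g as) \<subseteq> ?B \<union> F \<Longrightarrow>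
          \<exists>g'\<in>G. map g' as = map g as \<and> g' c \<in> W" by blast
    let ?A' = "?B \<union> W \<union> ({n} - F)"
    have ext: "\<exists>g'\<in>G. map g' as' = map g as' \<and> g' c' \<in> ?A' - A"
      if "task n = (as', c')" "c' \<notin> F \<union> set as'" "g \<in> G" "set (map g as') \<subseteq> A \<union> d ` A \<union> F" for as' c' g
    proof -
      have "as' = as" "c' = c" using t that by auto
      with that obtain g' where "g' \<in> G" "map g' as' = map g as'" "g' c' \<in> W"
        using W(3)[of g] by (metis (no_types))
      then show ?thesis using W(2) by blast
    qed
    show "\<exists>A'. (finite A' \<and> A' \<inter> F = {}) \<and> (\<exists>d. ?R n A A' d)"
    proof (intro exI[of _ ?A'] exI[of _ d] conjI)
      show "finite ?A'" using A W by auto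
      show "?A' \<inter> F = {}" using A W d(2) by auto
      show "\<forall>c. \<exists>g\<in>G. \<forall>a\<in>A. g a = (if c a then d a else a)" using d(3) by blast
      show "\<forall>as c g. task n = (as, c) \<longrightarrow> c \<notin> F \<union> set as \<longrightarrow> g \<in> G \<longrightarrow> set (map g as) \<subseteq> A \<union> d ` A \<union> F \<longrightarrow>
       (\<exists>g'\<in>G. map g' as = map g as \<and> g' c \<in> ?A' - A)" using ext by blast
    qed (use d in auto)
  qed
  then obtain A where A: "\<forall>n. (finite (A n) \<and> A n \<inter> F = {}) \<and> (\<exists>d. ?R n (A n) (A (Suc n)) d)" ..
  then have "\<forall>n. \<exists>d. ?R n (A n) (A (Suc n)) d" by simp
  from choice[OF this] obtain d where d: "\<forall>n. ?R n (A n) (A (Suc n)) (d n)" ..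
  show thesis
  proof (rule that[of A d])
    show "\<exists>g'\<in>G. map g' as = map g as \<and> g' c \<in> A (Suc n) - A n"
      if "task n = (as, c)" "c \<notin> F \<union> set as" "g \<in> G" "set (map g as) \<subseteq> A n \<union> d n ` A n \<union> F" for n as c g
      using d that by blast
  qed (simp_all add: A d)
qed

end

section \<open>The motion of the particles\<close>

text \<open>By \<open>task_recurs\<close> every demand can still be answered after any given time.
  The list \<open>fs\<close> enumerates \<open>F\<close>, and \<open>c0\<close> replaces random
  starting points that fall into \<open>F\<close>.\<close>

locale particle_system = infinite_orbits +
  fixes A :: "nat \<Rightarrow> nat set" and d :: "nat \<Rightarrow> nat \<Rightarrow> nat" and task :: "nat \<Rightarrow> nat list \<times> nat"
    and fs :: "nat list" and c0 :: nat
  assumes A_F: "A n \<inter> F = {}" and A_Suc: "A n \<subseteq> A (Suc n)" and A_covers: "n \<notin> F \<Longrightarrow> n \<in> A (Suc n)"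
    and d_A: "d n ` A n \<subseteq> A (Suc n)" and d_inj: "inj_on (d n) (A n)" and d_new: "d n ` A n \<inter> A n = {}"
    and moves: "\<exists>g\<in>G. \<forall>a\<in>A n. g a = (if \<kappa> a then d n a else a)"
    and extensions: "task n = (as, c) \<Longrightarrow> c \<notin> F \<union> set as \<Longrightarrow> g \<in> G \<Longrightarrow>
       set (map g as) \<subseteq> A n \<union> d n ` A n \<union> F \<Longrightarrow> \<exists>g'\<in>G. map g' as = map g as \<and> g' c \<in> A (Suc n) - A n"
    and task_recurs: "\<exists>n\<ge>m. task n = (as, c)"
    and fs: "distinct fs" "set fs = F" and c0: "c0 \<notin> F"
begin

text \<open>\<open>x (i, 0)\<close> is the starting position of particle \<open>i\<close> and \<open>x (i, Suc n)\<close> its coin at time \<open>n\<close>.\<close>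

fun pos :: "(nat \<times> nat \<Rightarrow> nat) \<Rightarrow> nat \<Rightarrow> nat \<Rightarrow> nat" where
  "pos x 0 i = (if x (i, 0) \<in> F then c0 else x (i, 0))"
| "pos x (Suc n) i = (if pos x n i \<in> A n \<and> x (i, Suc n) = 0 then d n (pos x n i) else pos x n i)"

text \<open>The particles in the list \<open>\<phi>\<close> sit still on the exceptional set \<open>F\<close>.\<close>

definition val :: "nat list \<Rightarrow> (nat \<times> nat \<Rightarrow> nat) \<Rightarrow> nat \<Rightarrow> nat \<Rightarrow> nat" where
  "val \<phi> x n i = (case map_of (zip \<phi> fs) i of Some a \<Rightarrow> a | None \<Rightarrow> pos x n i)"

text \<open>The almost sure event on which everything works: disagreeing coins separate particles,
  and recurring starting points supply the witnesses of the back direction.\<close>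

definition good :: "(nat \<times> nat \<Rightarrow> nat) \<Rightarrow> bool" where
  "good x \<longleftrightarrow> (\<forall>i j m. i \<noteq> j \<longrightarrow> (\<exists>n\<ge>m. x (i, Suc n) = 0 \<longleftrightarrow> x (j, Suc n) \<noteq> 0)) \<and>
     (\<forall>a m. \<exists>i\<ge>m. x (i, 0) = a)"

text \<open>The particle at index \<open>k\<close> of a placement occupies \<open>fs ! k\<close>.
  There are countably many placements, and permutations of the particles act on them.\<close>

definition placements :: "nat list set" where
  "placements = {\<phi>. distinct \<phi> \<and> length \<phi> = length fs}"

lemma mono_A: "m \<le> n \<Longrightarrow> A m \<subseteq> A n"
  using A_Suc by (rule lift_Suc_mono_le)

lemma pos_notin_F: "pos x n i \<notin> F"
proof (induction n)
  case (Suc n)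
  have "d n (pos x n i) \<notin> F" if "pos x n i \<in> A n"
    using that d_A[of n] A_F[of "Suc n"] by blast
  then show ?case using Suc by simp
qed (simp add: c0)

lemma pos_in_A_Suc: "pos x n i \<in> A n \<Longrightarrow> pos x (Suc n) i \<in> A (Suc n)"
  using A_Suc[of n] d_A[of n] by auto

lemma pos_initial_or_in_A: "pos x n i = pos x 0 i \<or> pos x n i \<in> A n"
proof (induction n)
  case (Suc n)
  show ?case
  proof (cases "pos x n i \<in> A n")
    case True
    then show ?thesis using pos_in_A_Suc by blast
  next
    case False
    then show ?thesis using Suc by simp
  qed
qed simp

text \<open>The move at time \<open>n\<close> affects only particles in \<open>A n\<close>, and the
  sets \<open>A\<close> increase; so a particle starting outside \<open>A n\<close> waits up to and
  including time \<open>Suc n\<close>.\<close>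

lemma pos_initial: "pos x 0 i \<notin> A n \<Longrightarrow> m \<le> Suc n \<Longrightarrow> pos x m i = pos x 0 i"
proof (induction m)
  case (Suc m)
  then have "pos x m i = pos x 0 i" by simp
  moreover have "pos x 0 i \<notin> A m" using Suc mono_A[of m n] by auto
  ultimately show ?case by simp
qed simp

text \<open>The starting point \<open>a\<close> enters the exhaustion by stage \<open>Suc a\<close>,
  and a particle inside it never leaves.\<close>

lemma eventually_pos_in_A: "eventually (\<lambda>n. pos x n i \<in> A n) sequentially"
proof -
  have "pos x n i \<in> A n" if "n \<ge> Suc (pos x 0 i)" for n
    using pos_initial_or_in_A[of x n i] A_covers[OF pos_notin_F[of x 0 i]] mono_A[OF that] by auto
  then show ?thesis unfolding eventually_sequentially by blast
qed

text \<open>Two movers stay apart because \<open>d n\<close> is injective, a mover and a stayer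
  because \<open>d n\<close> leads out of \<open>A n\<close>.\<close>

lemma pos_neq_Suc:
  assumes "pos x n i \<in> A n" "pos x n j \<in> A n" "pos x n i \<noteq> pos x n j"
  shows "pos x (Suc n) i \<noteq> pos x (Suc n) j"
proof -
  have "d n a \<noteq> b" if "a \<in> A n" "b \<in> A n" for a b using that d_new[of n] by blast
  moreover have "d n (pos x n i) \<noteq> d n (pos x n j)" using assms d_inj[of n] by (simp add: inj_on_eq_iff)
  ultimately show ?thesis using assms unfolding pos.simps by (simp split: if_split) metis
qed

text \<open>Once both particles are in the exhaustion, the next disagreement of their coins
  separates them if they are still together, and afterwards they cannot meet again.\<close>

lemma eventually_pos_neq:
  assumes "good x" "i \<noteq> j"
  shows "eventually (\<lambda>n. pos x n i \<noteq> pos x n j) sequentially"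
proof -
  have "eventually (\<lambda>n. pos x n i \<in> A n \<and> pos x n j \<in> A n) sequentially"
    by (intro eventually_conj eventually_pos_in_A)
  then obtain m where m: "\<And>n. n \<ge> m \<Longrightarrow> pos x n i \<in> A n \<and> pos x n j \<in> A n"
    unfolding eventually_sequentially by blast
  have "\<exists>n\<ge>m. pos x n i \<noteq> pos x n j"
  proof -
    have "\<exists>n\<ge>m. x (i, Suc n) = 0 \<longleftrightarrow> x (j, Suc n) \<noteq> 0" using assms by (simp add: good_def)
    then obtain n where n: "n \<ge> m" "x (i, Suc n) = 0 \<longleftrightarrow> x (j, Suc n) \<noteq> 0" by (elim exE conjE)
    have "pos x (Suc n) i \<noteq> pos x (Suc n) j" if "pos x n i = pos x n j"
      using that m[OF n(1)] n(2) d_new[of n] by auto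
    then show ?thesis using n(1) le_SucI by blast
  qed
  then obtain n0 where n0: "n0 \<ge> m" "pos x n0 i \<noteq> pos x n0 j" by blast
  have "pos x n i \<noteq> pos x n j" if "n \<ge> n0" for n
    using that
  proof (induction n rule: dec_induct)
    case (step n)
    then show ?case using pos_neq_Suc m[of n] n0(1) by simp
  qed (rule n0(2))
  then show ?thesis unfolding eventually_sequentially by blast
qed

text \<open>From such a time on, each joint step of the particles in the list is induced by a single
  element of \<open>G\<close>.\<close>

definition stable :: "nat list \<Rightarrow> (nat \<times> nat \<Rightarrow> nat) \<Rightarrow> nat \<Rightarrow> nat list \<Rightarrow> bool" where
  "stable \<phi> x n is \<longleftrightarrow> val \<phi> x n ` set is \<subseteq> A n \<union> F \<and> inj_on (val \<phi> x n) (set is)"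

text \<open>The back-and-forth relation between tuples of particles and tuples of \<open>N\<close>:
  the current positions lie in the \<open>G\<close>-orbit of \<open>as\<close>. Stability makes it
  persist in time.\<close>

definition related :: "nat list \<Rightarrow> (nat \<times> nat \<Rightarrow> nat) \<Rightarrow> nat \<Rightarrow> nat list \<Rightarrow> nat list \<Rightarrow> bool" where
  "related \<phi> x n is as \<longleftrightarrow> stable \<phi> x n is \<and> (\<exists>g\<in>G. as = map g (map (val \<phi> x n) is))"

context
  fixes \<phi> :: "nat list" and x :: "nat \<times> nat \<Rightarrow> nat"
  assumes \<phi>: "\<phi> \<in> placements"
begin

lemma map_of_placement:
  "map_of (zip \<phi> fs) i = Some a \<longleftrightarrow> (\<exists>k<length fs. i = \<phi> ! k \<and> a = fs ! k)"
  using \<phi> by (auto simp: placements_def map_of_zip_nth in_set_zip dest!: map_of_SomeD)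

lemma val_cases:
  obtains (fixed) k where "k < length fs" "i = \<phi> ! k" "\<And>n. val \<phi> x n i = fs ! k" "fs ! k \<in> F"
  | (moving) "i \<notin> set \<phi>" "\<And>n. val \<phi> x n i = pos x n i"
proof (cases "map_of (zip \<phi> fs) i")
  case None
  then have "i \<notin> set \<phi>" using \<phi> by (simp add: placements_def map_of_zip_is_None)
  then show ?thesis using None moving by (simp add: val_def)
next
  case (Some a)
  then obtain k where "k < length fs" "i = \<phi> ! k" "a = fs ! k" using map_of_placement by blast
  then show ?thesis using Some fixed[of k] fs(2) nth_mem by (auto simp: val_def)
qed

lemma val_fixed: "k < length fs \<Longrightarrow> val \<phi> x n (\<phi> ! k) = fs ! k"
  using map_of_placement[of "\<phi> ! k" "fs ! k"] by (auto simp: val_def)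

lemma val_neq:
  assumes "good x" "i \<noteq> j"
  shows "eventually (\<lambda>n. val \<phi> x n i \<noteq> val \<phi> x n j) sequentially"
proof (cases rule: val_cases[of i])
  case i: (fixed k)
  show ?thesis
  proof (cases rule: val_cases[of j])
    case j: (fixed l)
    then have "k \<noteq> l" using i assms by auto
    then show ?thesis using i j fs(1) by (simp add: nth_eq_iff_index_eq)
  next
    case moving
    have "fs ! k \<noteq> pos x n j" for n using i(4) pos_notin_F[of x n j] by metis
    then show ?thesis using i(3) moving(2) by simp
  qed
next
  case i: moving
  show ?thesis
  proof (cases rule: val_cases[of j])
    case (fixed l)
    have "pos x n i \<noteq> fs ! l" for n using fixed(4) pos_notin_F[of x n i] by metis
    then show ?thesis using i(2) fixed(3) by simp
  next
    case moving
    then show ?thesis using i eventually_pos_neq[OF assms] by simp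
  qed
qed

lemma eventually_stable:
  assumes "good x"
  shows "eventually (\<lambda>n. stable \<phi> x n is) sequentially"
proof -
  have "eventually (\<lambda>n. val \<phi> x n i \<in> A n \<union> F) sequentially" for i
  proof (cases rule: val_cases[of i])
    case moving
    then show ?thesis using eventually_pos_in_A[of x i] by (auto elim: eventually_mono)
  qed simp
  moreover have "eventually (\<lambda>n. i \<noteq> j \<longrightarrow> val \<phi> x n i \<noteq> val \<phi> x n j) sequentially" for i j
    using val_neq[OF assms, of i j] by (cases "i = j") simp_all
  ultimately have "eventually (\<lambda>n. (\<forall>i\<in>set is. val \<phi> x n i \<in> A n \<union> F) \<and>
      (\<forall>i\<in>set is. \<forall>j\<in>set is. i \<noteq> j \<longrightarrow> val \<phi> x n i \<noteq> val \<phi> x n j)) sequentially"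
    by (intro eventually_conj eventually_ball_finite ballI) auto
  then show ?thesis by (rule eventually_mono) (auto simp: stable_def inj_on_def)
qed

text \<open>The third claim is sharper than membership in \<open>A (Suc n)\<close>: it has the form
  required by \<open>extensions\<close>, where fresh values are provided.\<close>

lemma val_Suc_stable:
  assumes "stable \<phi> x n is"
  shows "stable \<phi> x (Suc n) is" "\<exists>g\<in>G. map (val \<phi> x (Suc n)) is = map g (map (val \<phi> x n) is)"
    "val \<phi> x (Suc n) ` set is \<subseteq> A n \<union> d n ` A n \<union> F"
proof -
  \<comment> \<open>The coins belong to particles but \<open>moves\<close> expects a pattern on
    positions. Stability makes the positions distinct, so the pattern reproduces every coin
    faithfully.\<close>
  let ?c = "\<lambda>a. \<exists>i\<in>set is. val \<phi> x n i = a \<and> x (i, Suc n) = 0"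
  obtain g where g: "g \<in> G" "\<And>a. a \<in> A n \<Longrightarrow> g a = (if ?c a then d n a else a)"
    using moves[of n ?c] by blast
  have step: "val \<phi> x (Suc n) i = g (val \<phi> x n i) \<and> val \<phi> x (Suc n) i \<in> A n \<union> d n ` A n \<union> F" if i: "i \<in> set is" for i
  proof (cases rule: val_cases[of i])
    case (fixed k)
    then show ?thesis using fix_F[OF g(1)] by simp
  next
    case moving
    then have a: "val \<phi> x n i \<in> A n" using assms i pos_notin_F[of x n i] by (auto simp: stable_def)
    have "?c (val \<phi> x n i) \<longleftrightarrow> x (i, Suc n) = 0"
      using assms i by (auto simp: stable_def inj_on_def)
    then show ?thesis using g(2)[OF a] moving a by simp
  qed
  show "\<exists>g\<in>G. map (val \<phi> x (Suc n)) is = map g (map (val \<phi> x n) is)"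
    using g(1) step by (intro bexI[of _ g]) auto
  show sub: "val \<phi> x (Suc n) ` set is \<subseteq> A n \<union> d n ` A n \<union> F" using step by blast
  have "inj_on (val \<phi> x (Suc n)) (set is)"
  proof (rule inj_onI)
    fix i j assume ij: "i \<in> set is" "j \<in> set is" "val \<phi> x (Suc n) i = val \<phi> x (Suc n) j"
    then have "g (val \<phi> x n i) = g (val \<phi> x n j)" using step by simp
    then have "val \<phi> x n i = val \<phi> x n j" using bij_G[OF g(1)] by (simp add: bij_is_inj inj_eq)
    then show "i = j" using assms ij by (simp add: stable_def inj_on_def)
  qed
  then show "stable \<phi> x (Suc n) is" using sub A_Suc[of n] d_A[of n] unfolding stable_def by blast
qed

text \<open>If \<open>h\<close> induces the step, the witness \<open>g\<close> is replaced by
  \<open>g \<circ> inv h\<close>.\<close>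

lemma related_mono:
  assumes "related \<phi> x n is as" "n \<le> m"
  shows "related \<phi> x m is as"
  using assms(2)
proof (induction m rule: dec_induct)
  case (step m)
  then obtain g where g: "g \<in> G" "as = map g (map (val \<phi> x m) is)" and st: "stable \<phi> x m is"
    by (auto simp: related_def)
  obtain h where h: "h \<in> G" "map (val \<phi> x (Suc m)) is = map h (map (val \<phi> x m) is)"
    using val_Suc_stable(2)[OF st] by blast
  have "as = map (g \<circ> inv h) (map h (map (val \<phi> x m) is))"
    unfolding g(2) using G_inverse[OF h(1)] by simp
  then show ?case
    unfolding related_def h(2) using val_Suc_stable(1)[OF st] comp_G[OF g(1) inv_G[OF h(1)]] by blast
qed (rule assms(1))

lemma related_sub:
  assumes "related \<phi> x n is (map h is)" "set js \<subseteq> set is"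
  shows "related \<phi> x n js (map h js)"
proof -
  obtain g where g: "g \<in> G" "map h is = map g (map (val \<phi> x n) is)"
    using assms by (auto simp: related_def)
  then have "h i = g (val \<phi> x n i)" if "i \<in> set is" for i using that by auto
  then have "map h js = map g (map (val \<phi> x n) js)" using assms(2) by auto
  moreover have "stable \<phi> x n js" using assms unfolding related_def stable_def by (auto intro: inj_on_subset)
  ultimately show ?thesis using g(1) unfolding related_def by blast
qed

lemma related_forth:
  assumes "good x" "related \<phi> x n is as"
  shows "\<exists>b m. related \<phi> x m (is @ [j]) (as @ [b])"
proof -
  obtain m0 where m0: "\<And>m. m \<ge> m0 \<Longrightarrow> stable \<phi> x m (is @ [j])"
    using eventually_stable[OF assms(1)] unfolding eventually_sequentially by blast
  have "related \<phi> x (max m0 n) is as" using related_mono[OF assms(2)] by simp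
  then obtain g where "g \<in> G" "as = map g (map (val \<phi> x (max m0 n)) is)" by (auto simp: related_def)
  then have "related \<phi> x (max m0 n) (is @ [j]) (as @ [g (val \<phi> x (max m0 n) j)])"
    unfolding related_def using m0 by auto
  then show ?thesis by blast
qed

text \<open>A point of \<open>F\<close> is represented by the particle placed on it, an entry of
  \<open>as\<close> by a particle already listed. Any other point is represented by a particle that
  started at a fresh value and still waits there.\<close>

lemma related_back:
  assumes good: "good x" and rel: "related \<phi> x n is as"
  shows "\<exists>j m. related \<phi> x m (is @ [j]) (as @ [b])"
proof -
  consider (F) "b \<in> F" | (old) "b \<in> set as" | (new) "b \<notin> F \<union> set as" by blast
  then show ?thesis
  proof cases
    case F
    then obtain k where k: "k < length fs" "b = fs ! k" using fs(2) by (metis in_set_conv_nth)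
    obtain m0 where m0: "\<And>m. m \<ge> m0 \<Longrightarrow> stable \<phi> x m (is @ [\<phi> ! k])"
      using eventually_stable[OF good] unfolding eventually_sequentially by blast
    have "related \<phi> x (max m0 n) is as" using related_mono[OF rel] by simp
    then obtain g where g: "g \<in> G" "as = map g (map (val \<phi> x (max m0 n)) is)" by (auto simp: related_def)
    then have "as @ [b] = map g (map (val \<phi> x (max m0 n)) (is @ [\<phi> ! k]))"
      using val_fixed[OF k(1)] fix_F[OF g(1) F] k(2) by simp
    then have "related \<phi> x (max m0 n) (is @ [\<phi> ! k]) (as @ [b])"
      unfolding related_def using m0 g(1) by auto
    then show ?thesis by blast
  next
    case old
    obtain g where g: "g \<in> G" "as = map g (map (val \<phi> x n) is)" and st: "stable \<phi> x n is"
      using rel by (auto simp: related_def)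
    then obtain j where j: "j \<in> set is" "b = g (val \<phi> x n j)" using old by auto
    then have "stable \<phi> x n (is @ [j])" using st by (simp add: stable_def insert_absorb)
    then have "related \<phi> x n (is @ [j]) (as @ [b])" unfolding related_def using g j by auto
    then show ?thesis by blast
  next
    case new
    \<comment> \<open>The demand is taken up at a time when \<open>is\<close> is already
      stable.\<close>
    obtain m where m: "m \<ge> n" "task m = (as, b)" using task_recurs by blast
    have relm: "related \<phi> x m is as" "related \<phi> x (Suc m) is as"
      using related_mono[OF rel] m(1) by auto
    then obtain g where g: "g \<in> G" "as = map g (map (val \<phi> x (Suc m)) is)" by (auto simp: related_def)
    then have inv_as: "map (inv g) as = map (val \<phi> x (Suc m)) is" using G_inverse[OF g(1)] by (simp add: o_def)
    have "set (map (inv g) as) \<subseteq> A m \<union> d m ` A m \<union> F"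
      unfolding inv_as using val_Suc_stable(3)[of m "is"] relm(1) by (auto simp: related_def)
    from extensions[OF m(2) new inv_G[OF g(1)] this]
    obtain g' where g': "g' \<in> G" "map g' as = map (val \<phi> x (Suc m)) is" "g' b \<in> A (Suc m) - A m"
      unfolding inv_as by blast
    \<comment> \<open>Infinitely many particles start at the fresh value; one beyond all entries of
      \<open>\<phi>\<close> is not among those placed on \<open>F\<close>.\<close>
    obtain j where j: "j \<ge> Suc (Max (insert 0 (set \<phi>)))" "x (j, 0) = g' b"
      using good unfolding good_def by blast
    have "j \<notin> set \<phi>"
    proof
      assume "j \<in> set \<phi>"
      then have "j \<le> Max (insert 0 (set \<phi>))" by (intro Max_ge) auto
      then show False using j(1) by simp
    qed
    moreover have "g' b \<notin> F" using g'(3) A_F by blast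
    ultimately have vj: "val \<phi> x (Suc m) j = g' b"
      using pos_initial[of x j m "Suc m"] j(2) g'(3)
      by (cases rule: val_cases[of j]) (use \<phi> in \<open>auto simp: placements_def simp del: pos.simps(2)\<close>)
    have notin: "g' b \<notin> val \<phi> x (Suc m) ` set is"
    proof
      assume "g' b \<in> val \<phi> x (Suc m) ` set is"
      then have "g' b \<in> set (map g' as)" unfolding g'(2) by simp
      then have "g' b \<in> g' ` set as" by simp
      then show False using new bij_G[OF g'(1)] by (auto simp: bij_is_inj inj_image_mem_iff)
    qed
    have "stable \<phi> x (Suc m) (is @ [j])"
    proof -
      have "stable \<phi> x (Suc m) is" using relm by (simp add: related_def)
      moreover have "j \<notin> set is" using notin vj by (metis imageI)
      ultimately show ?thesis using vj notin g'(3) by (simp add: stable_def)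
    qed
    moreover have "as @ [b] = map (inv g') (map (val \<phi> x (Suc m)) (is @ [j]))"
      using vj g'(2)[symmetric] G_inverse[OF g'(1)] by (simp add: o_def)
    ultimately have "related \<phi> x (Suc m) (is @ [j]) (as @ [b])"
      unfolding related_def using inv_G[OF g'(1)] by blast
    then show ?thesis by blast
  qed
qed

text \<open>Back-and-forth for the relation "related at some time". Any finite tuple of particles is
  part of a related one, so its positions eventually stay in the orbit of its image under
  \<open>h\<close>.\<close>

lemma limit_bijection:
  assumes good: "good x"
  obtains h where "bij h" "\<And>is. eventually (\<lambda>n. related \<phi> x n is (map h is)) sequentially"
proof -
  let ?P = "\<lambda>is as. \<exists>n. related \<phi> x n is as"
  obtain h where h: "bij h" "\<And>n. \<exists>is. ?P is (map h is) \<and> {..<n} \<subseteq> set is"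
  proof (rule back_and_forth[of ?P "[]" "[]"])
    show "?P [] []" using id_G by (auto simp: related_def stable_def)
    show "length is = length as" if "?P is as" for "is" as using that by (auto simp: related_def)
    show "is ! i = is ! j \<longleftrightarrow> as ! i = as ! j" if P: "?P is as" "i < length is" "j < length is" for "is" as i j
    proof -
      obtain n g where g: "g \<in> G" "as = map g (map (val \<phi> x n) is)" and "stable \<phi> x n is"
        using P(1) unfolding related_def by blast
      then have "val \<phi> x n (is ! i) = val \<phi> x n (is ! j) \<longleftrightarrow> is ! i = is ! j"
        using P by (auto simp: stable_def inj_on_def)
      then show ?thesis using g P bij_G[OF g(1)] by (auto simp: bij_is_inj inj_eq)
    qed
    show "\<exists>b. ?P (is @ [y]) (as @ [b])" if "?P is as" for "is" as y
      using related_forth[OF good] that by blast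
    show "\<exists>y. ?P (is @ [y]) (as @ [b])" if "?P is as" for "is" as b
      using related_back[OF good] that by blast
  qed blast
  show thesis
  proof (rule that[OF h(1)])
    fix js :: "nat list"
    obtain k where "set js \<subseteq> {..<k}" using finite_nat_bounded[of "set js"] by auto
    then obtain "is" n where "related \<phi> x n is (map h is)" "set js \<subseteq> set is" using h(2)[of k] by blast
    then have "related \<phi> x n js (map h js)" by (rule related_sub)
    then show "eventually (\<lambda>n. related \<phi> x n js (map h js)) sequentially"
      unfolding eventually_sequentially using related_mono by blast
  qed
qed

end

end

section \<open>The limit structure on the set of particles\<close>

locale particle_structure = particle_system +
  fixes L :: "('r, 'f) language" and N :: "('r, 'f) struct"
  assumes G_Aut: "G \<subseteq> Aut L N"
begin

text \<open>For a good sample and a placement exactly one particle eventually follows the function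
  value, and \<open>LEAST\<close> names it; on other samples \<open>LEAST\<close> merely keeps the
  definition total.\<close>

definition limit_structure :: "nat list \<Rightarrow> (nat \<times> nat \<Rightarrow> nat) \<Rightarrow> ('r, 'f) struct" where
  "limit_structure \<phi> x =
     ((\<lambda>R\<in>rel_syms L. \<lambda>is\<in>tuples (rel_arity L R). eventually (\<lambda>n. fst N R (map (val \<phi> x n) is)) sequentially),
      (\<lambda>f\<in>fun_syms L. \<lambda>is\<in>tuples (fun_arity L f).
         LEAST j. eventually (\<lambda>n. snd N f (map (val \<phi> x n) is) = val \<phi> x n j) sequentially))"

lemma limit_structure_in_Str: "limit_structure \<phi> x \<in> Str L"
  by (auto simp: limit_structure_def Str_def)

text \<open>Eventually an automorphism of \<open>N\<close> carries the positions to their images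
  under \<open>h\<close>, so the truth value of the atom is eventually constant and equals the one
  at \<open>h\<close>.\<close>

lemma limit_structure_values:
  assumes \<phi>: "\<phi> \<in> placements" and good: "good x"
  obtains h where "bij h"
    "\<And>R is. R \<in> rel_syms L \<Longrightarrow> length is = rel_arity L R \<Longrightarrow>
       eventually (\<lambda>n. fst N R (map (val \<phi> x n) is)) sequentially \<longleftrightarrow> fst N R (map h is)"
    "\<And>f is j. f \<in> fun_syms L \<Longrightarrow> length is = fun_arity L f \<Longrightarrow>
       eventually (\<lambda>n. snd N f (map (val \<phi> x n) is) = val \<phi> x n j) sequentially \<longleftrightarrow> snd N f (map h is) = h j"
proof -
  obtain h where h: "bij h" "\<And>is. eventually (\<lambda>n. related \<phi> x n is (map h is)) sequentially"
    by (rule limit_bijection[OF \<phi> good], rule that)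
  have const: "eventually (\<lambda>n. Q n) sequentially \<longleftrightarrow> q"
    if "eventually (\<lambda>n. Q n \<longleftrightarrow> q) sequentially" for Q :: "nat \<Rightarrow> bool" and q
    using eventually_cong[OF that] by (simp add: eventually_const)
  show thesis
  proof (rule that[OF h(1)])
    fix R and "is" :: "nat list" assume R: "R \<in> rel_syms L" "length is = rel_arity L R"
    show "eventually (\<lambda>n. fst N R (map (val \<phi> x n) is)) sequentially \<longleftrightarrow> fst N R (map h is)"
    proof (rule const, rule eventually_mono[OF h(2)[of "is"]])
      fix n assume "related \<phi> x n is (map h is)"
      then obtain g where g: "g \<in> G" "map h is = map g (map (val \<phi> x n) is)" by (auto simp: related_def)
      then have "isomorphism L N N g" using G_Aut by (auto simp: Aut_def)
      then have "\<forall>as\<in>tuples (rel_arity L R). fst N R as \<longleftrightarrow> fst N R (map g as)"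
        using R(1) unfolding isomorphism_def by blast
      then show "fst N R (map (val \<phi> x n) is) \<longleftrightarrow> fst N R (map h is)"
        unfolding g(2) using R(2) by (elim ballE[of _ _ "map (val \<phi> x n) is"]) (simp_all only: tuples_def length_map mem_Collect_eq not_True_eq_False)
    qed
  next
    fix f j and "is" :: "nat list" assume f: "f \<in> fun_syms L" "length is = fun_arity L f"
    show "eventually (\<lambda>n. snd N f (map (val \<phi> x n) is) = val \<phi> x n j) sequentially \<longleftrightarrow> snd N f (map h is) = h j"
    proof (rule const, rule eventually_mono[OF h(2)[of "is @ [j]"]])
      fix n assume "related \<phi> x n (is @ [j]) (map h (is @ [j]))"
      then obtain g where g: "g \<in> G" "map h is = map g (map (val \<phi> x n) is)" "h j = g (val \<phi> x n j)"
        by (auto simp: related_def)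
      then have iso: "isomorphism L N N g" using G_Aut by (auto simp: Aut_def)
      then have "snd N f (map h is) = g (snd N f (map (val \<phi> x n) is))"
        unfolding g(2) using f by (simp add: isomorphism_def tuples_def)
      then show "snd N f (map (val \<phi> x n) is) = val \<phi> x n j \<longleftrightarrow> snd N f (map h is) = h j"
        unfolding g(3) using bij_G[OF g(1)] by (auto simp: bij_is_inj inj_eq)
    qed
  qed
qed

lemma limit_structure_iso:
  assumes "\<phi> \<in> placements" "good x"
  shows "limit_structure \<phi> x \<in> iso_class L N"
proof -
  obtain h where h: "bij h"
    "\<And>R is. R \<in> rel_syms L \<Longrightarrow> length is = rel_arity L R \<Longrightarrow>
       eventually (\<lambda>n. fst N R (map (val \<phi> x n) is)) sequentially \<longleftrightarrow> fst N R (map h is)"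
    "\<And>f is j. f \<in> fun_syms L \<Longrightarrow> length is = fun_arity L f \<Longrightarrow>
       eventually (\<lambda>n. snd N f (map (val \<phi> x n) is) = val \<phi> x n j) sequentially \<longleftrightarrow> snd N f (map h is) = h j"
    by (rule limit_structure_values[OF assms], rule that)
  have "h (LEAST j. snd N f (map h is) = h j) = snd N f (map h is)" for f "is"
    using LeastI_ex[of "\<lambda>j. snd N f (map h is) = h j"] bij_is_surj[OF h(1)] by (metis surjD)
  then have "isomorphism L (limit_structure \<phi> x) N h"
    using h unfolding isomorphism_def limit_structure_def by (simp add: tuples_def)
  then show ?thesis using limit_structure_in_Str unfolding iso_class_def by blast
qed

text \<open>The motion treats all particles alike, so relabelling samples and placement only
  relabels the positions.\<close>

lemma val_permute:
  assumes "bij \<gamma>"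
  shows "val (map \<gamma> \<phi>) (\<lambda>(i, n). x (inv \<gamma> i, n)) n i = val \<phi> x n (inv \<gamma> i)"
proof -
  have inv: "inv \<gamma> (\<gamma> a) = a" "\<gamma> (inv \<gamma> a) = a" for a
    using assms by (auto simp: bij_is_inj bij_is_surj surj_f_inv_f)
  have "map_of (zip (map \<gamma> \<phi>) ys) i = map_of (zip \<phi> ys) (inv \<gamma> i)" for ys :: "nat list"
  proof (induction \<phi> arbitrary: ys)
    case (Cons a \<phi>)
    then show ?case using inv by (cases ys) auto
  qed simp
  moreover have "pos (\<lambda>(i, n). x (inv \<gamma> i, n)) n i = pos x n (inv \<gamma> i)"
    by (induction n) simp_all
  ultimately show ?thesis unfolding val_def by (simp only:)
qed

text \<open>Equivariance under relabelling. For function symbols \<open>good\<close> is essential to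
  the argument: a least index is not respected by relabelling, a unique one is.\<close>

lemma limit_structure_permute:
  assumes \<phi>: "\<phi> \<in> placements" and good: "good x" and \<gamma>: "bij \<gamma>"
  shows "limit_structure (map \<gamma> \<phi>) (\<lambda>(i, n). x (inv \<gamma> i, n)) = logic_action L \<gamma> (limit_structure \<phi> x)"
proof (rule Str_eqI[OF limit_structure_in_Str logic_action_in_Str])
  have m: "map (val (map \<gamma> \<phi>) (\<lambda>(i, n). x (inv \<gamma> i, n)) n) is = map (val \<phi> x n) (map (inv \<gamma>) is)" for n and "is" :: "nat list"
    using val_permute[OF \<gamma>] by simp
  fix R and "is" :: "nat list" assume R: "R \<in> rel_syms L" "length is = rel_arity L R"
  show "fst (limit_structure (map \<gamma> \<phi>) (\<lambda>(i, n). x (inv \<gamma> i, n))) R is = fst (logic_action L \<gamma> (limit_structure \<phi> x)) R is"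
    unfolding logic_action_rel[OF R] using R by (simp add: limit_structure_def tuples_def m del: map_map)
next
  have inv: "inv \<gamma> (\<gamma> a) = a" "\<gamma> (inv \<gamma> a) = a" for a
    using \<gamma> by (auto simp: bij_is_inj bij_is_surj surj_f_inv_f)
  have m: "map (val (map \<gamma> \<phi>) (\<lambda>(i, n). x (inv \<gamma> i, n)) n) is = map (val \<phi> x n) (map (inv \<gamma>) is)" for n and "is" :: "nat list"
    using val_permute[OF \<gamma>] by simp
  obtain h where h: "bij h"
    "\<And>f is j. f \<in> fun_syms L \<Longrightarrow> length is = fun_arity L f \<Longrightarrow>
       eventually (\<lambda>n. snd N f (map (val \<phi> x n) is) = val \<phi> x n j) sequentially \<longleftrightarrow> snd N f (map h is) = h j"
    by (rule limit_structure_values[OF \<phi> good], rule that)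
  fix f and "is" :: "nat list" assume f: "f \<in> fun_syms L" "length is = fun_arity L f"
  obtain j where j: "snd N f (map h (map (inv \<gamma>) is)) = h j" using bij_is_surj[OF h(1)] by (metis surjD)
  have unique: "snd N f (map h (map (inv \<gamma>) is)) = h j' \<longleftrightarrow> j' = j" for j'
    unfolding j using h(1) by (auto simp: bij_is_inj inj_eq)
  have "snd (limit_structure (map \<gamma> \<phi>) (\<lambda>(i, n). x (inv \<gamma> i, n))) f is =
     (LEAST j'. eventually (\<lambda>n. snd N f (map (val \<phi> x n) (map (inv \<gamma>) is)) = val \<phi> x n (inv \<gamma> j')) sequentially)"
    using f by (simp add: limit_structure_def tuples_def m val_permute[OF \<gamma>] del: map_map)
  also have "\<dots> = (LEAST j'. inv \<gamma> j' = j)"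
    using h(2)[OF f(1), of "map (inv \<gamma>) is"] f(2) unique by simp
  also have "\<dots> = \<gamma> j" by (rule Least_equality) (use inv in auto)
  also have "j = (LEAST j'. j' = j)" by (rule Least_equality[symmetric]) auto
  also have "\<dots> = (LEAST j'. eventually (\<lambda>n. snd N f (map (val \<phi> x n) (map (inv \<gamma>) is)) = val \<phi> x n j') sequentially)"
    using h(2)[OF f(1), of "map (inv \<gamma>) is"] f(2) unique by simp
  also have "\<gamma> \<dots> = snd (logic_action L \<gamma> (limit_structure \<phi> x)) f is"
    using f by (simp add: logic_action_def limit_structure_def tuples_def del: map_map)
  finally show "snd (limit_structure (map \<gamma> \<phi>) (\<lambda>(i, n). x (inv \<gamma> i, n))) f is = snd (logic_action L \<gamma> (limit_structure \<phi> x)) f is" .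
qed

end

section \<open>The random structure\<close>

text \<open>The geometric law gives 0 probability 1/2 and every natural number positive probability,
  so one law serves both the fair coins and the starting points.\<close>

definition fair_source :: "(nat \<times> nat \<Rightarrow> nat) measure" where
  "fair_source = PiM UNIV (\<lambda>_. measure_pmf (geometric_pmf (1 / 2)))"

lemma prob_space_fair_source: "prob_space fair_source"
  unfolding fair_source_def by (rule prob_space_PiM) (rule measure_pmf.prob_space_axioms)

lemma space_fair_source [simp]: "space fair_source = UNIV"
  by (simp add: fair_source_def space_PiM)

lemma measurable_fair_source_component [measurable]:
  "(\<lambda>x. x t) \<in> measurable fair_source (count_space UNIV)"
proof -
  have "(\<lambda>x. x t) \<in> measurable fair_source (measure_pmf (geometric_pmf (1 / 2)))"
    unfolding fair_source_def by (rule measurable_component_singleton) simp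
  then show ?thesis by (simp cong: measurable_cong_sets)
qed

lemma fair_source_cylinder_in_sets: "{x. \<forall>t\<in>J. x t \<in> B t} \<in> sets fair_source"
proof -
  have "Measurable.pred fair_source (\<lambda>x. x t \<in> B t)" for t
    by (rule measurable_compose[OF measurable_fair_source_component]) simp
  then have "Measurable.pred fair_source (\<lambda>x. \<forall>t\<in>J. x t \<in> B t)"
    by (intro pred_intros_countable_bounded)
  then show ?thesis by (simp add: pred_def)
qed

lemma prob_fair_source_cylinder:
  assumes "finite J"
  shows "measure fair_source {x. \<forall>t\<in>J. x t \<in> B t} = (\<Prod>t\<in>J. measure (geometric_pmf (1 / 2)) (B t))"
proof -
  interpret product_prob_space "\<lambda>_ :: nat \<times> nat. measure_pmf (geometric_pmf (1 / 2))" UNIV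
    by unfold_locales
  have "emeasure fair_source {x. \<forall>t\<in>J. x t \<in> B t} = (\<Prod>t\<in>J. emeasure (geometric_pmf (1 / 2)) (B t))"
    using emeasure_PiM_Collect[of J B] assms by (simp add: fair_source_def space_PiM)
  then have "ennreal (measure fair_source {x. \<forall>t\<in>J. x t \<in> B t}) =
      ennreal (\<Prod>t\<in>J. measure (geometric_pmf (1 / 2)) (B t))"
    unfolding finite_measure.emeasure_eq_measure[OF prob_space.finite_measure[OF prob_space_fair_source]]
    by (simp add: measure_pmf.emeasure_eq_measure prod_ennreal)
  then show ?thesis by (simp add: prod_nonneg)
qed

text \<open>Any \<open>k\<close> independent starts miss \<open>a\<close> with probability
  \<open>?q ^ k\<close>, and \<open>?q < 1\<close>.\<close>

lemma AE_fair_source_start: "AE x in fair_source. \<exists>i\<ge>m. x (i, 0) = a"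
proof -
  interpret prob_space fair_source by (rule prob_space_fair_source)
  let ?p = "geometric_pmf (1 / 2)"
  let ?Z = "{x. \<forall>i\<ge>m. x (i, 0) \<noteq> a}" and ?q = "measure ?p (- {a})"
  have "?Z \<in> events"
  proof -
    have "Measurable.pred fair_source (\<lambda>x. \<forall>i\<in>{m..}. x (i, 0) \<noteq> a)" by measurable
    then show ?thesis by (simp add: pred_def Ball_def)
  qed
  moreover have "prob ?Z \<le> ?q ^ k" for k
  proof -
    have "prob ?Z \<le> prob {x. \<forall>t\<in>(\<lambda>i. (i, 0)) ` {m..<m + k}. x t \<in> - {a}}"
      by (rule finite_measure_mono[OF _ fair_source_cylinder_in_sets]) auto
    also have "\<dots> = (\<Prod>t\<in>(\<lambda>i. (i, 0 :: nat)) ` {m..<m + k}. ?q)"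
      by (rule prob_fair_source_cylinder) simp
    also have "\<dots> = ?q ^ k" by (simp add: card_image inj_on_def)
    finally show ?thesis .
  qed
  moreover have "?q < 1"
  proof -
    have "pmf ?p a > 0" by simp
    then show ?thesis
      using measure_pmf.prob_compl[of "{a}" ?p] by (simp add: measure_pmf_single Compl_eq_Diff_UNIV)
  qed
  then have "(\<lambda>k. ?q ^ k) \<longlonglongrightarrow> 0" by (intro LIMSEQ_power_zero) simp
  ultimately have "prob ?Z \<le> 0" by (intro LIMSEQ_le_const) blast+
  then have "emeasure fair_source ?Z = 0" by (simp add: emeasure_eq_measure measure_le_0_iff)
  with \<open>?Z \<in> events\<close> show ?thesis by (intro AE_I[of _ _ ?Z]) auto
qed

text \<open>Agreement during \<open>k\<close> steps splits into \<open>2 ^ k\<close> common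
  patterns, each of probability \<open>(1 / 2) ^ (2 * k)\<close>; the total
  \<open>(1 / 2) ^ k\<close> tends to 0.\<close>

lemma AE_fair_source_coins:
  assumes "i \<noteq> j"
  shows "AE x in fair_source. \<exists>n\<ge>m. x (i, Suc n) = 0 \<longleftrightarrow> x (j, Suc n) \<noteq> 0"
proof -
  interpret prob_space fair_source by (rule prob_space_fair_source)
  let ?p = "geometric_pmf (1 / 2)"
  let ?Z = "{x :: nat \<times> nat \<Rightarrow> nat. \<forall>n\<ge>m. x (i, Suc n) = 0 \<longleftrightarrow> x (j, Suc n) = 0}"
  have half: "measure ?p {0} = 1 / 2" "measure ?p (- {0}) = 1 / 2"
    using measure_pmf.prob_compl[of "{0}" ?p] by (simp_all add: measure_pmf_single Compl_eq_Diff_UNIV)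
  have "?Z \<in> events"
  proof -
    have "Measurable.pred fair_source (\<lambda>x. \<forall>n\<in>{m..}. x (i, Suc n) = 0 \<longleftrightarrow> x (j, Suc n) = 0)" by measurable
    then show ?thesis by (simp add: pred_def Ball_def)
  qed
  moreover have "prob ?Z \<le> (1 / 2) ^ k" for k
  proof -
    let ?J = "{i, j} \<times> Suc ` {m..<m + k}"
    \<comment> \<open>The set \<open>c\<close> consists of the times at which both coins show
      0.\<close>
    let ?B = "\<lambda>c t. if snd t \<in> c then {0 :: nat} else - {0}"
    let ?C = "Pow (Suc ` {m..<m + k})"
    have ev: "{x. \<forall>t\<in>?J. x t \<in> ?B c t} \<in> events" for c
      by (rule fair_source_cylinder_in_sets)
    have "?Z \<subseteq> (\<Union>c\<in>?C. {x. \<forall>t\<in>?J. x t \<in> ?B c t})"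
    proof
      fix x assume x: "x \<in> ?Z"
      let ?c = "{n \<in> Suc ` {m..<m + k}. x (i, n) = 0}"
      have "x (i, n) = 0 \<longleftrightarrow> x (j, n) = 0" if "n \<in> Suc ` {m..<m + k}" for n
        using that x by (elim imageE) simp
      then have "x \<in> {x. \<forall>t\<in>?J. x t \<in> ?B ?c t}" by (simp del: image_Suc_atLeastLessThan)
      then show "x \<in> (\<Union>c\<in>?C. {x. \<forall>t\<in>?J. x t \<in> ?B c t})" by (intro UN_I[of ?c]) auto
    qed
    then have "prob ?Z \<le> prob (\<Union>c\<in>?C. {x. \<forall>t\<in>?J. x t \<in> ?B c t})"
      by (rule finite_measure_mono) (rule sets.finite_UN, simp, rule ev)
    also have "\<dots> \<le> (\<Sum>c\<in>?C. prob {x. \<forall>t\<in>?J. x t \<in> ?B c t})"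
      by (rule finite_measure_subadditive_finite) (simp, use ev in blast)
    also have "\<dots> = (\<Sum>c\<in>?C. (1 / 2) ^ (2 * k))"
    proof (rule sum.cong)
      fix c
      have "prob {x. \<forall>t\<in>?J. x t \<in> ?B c t} = (\<Prod>t\<in>?J. measure ?p (?B c t))"
        by (rule prob_fair_source_cylinder) simp
      also have "\<dots> = (\<Prod>t\<in>?J. 1 / 2)" by (rule prod.cong) (use half in auto)
      also have "\<dots> = (1 / 2) ^ (2 * k)" using assms by (simp add: card_cartesian_product card_image mult_2)
      finally show "prob {x. \<forall>t\<in>?J. x t \<in> ?B c t} = (1 / 2) ^ (2 * k)" .
    qed simp
    also have "\<dots> = 2 ^ k * (1 / 2) ^ (2 * k)" by (simp add: card_Pow card_image)
    also have "\<dots> = (1 / 2) ^ k" by (simp add: power_mult power_mult_distrib[symmetric] power2_eq_square)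
    finally show ?thesis .
  qed
  moreover have "(\<lambda>k. (1 / 2) ^ k :: real) \<longlonglongrightarrow> 0" by (intro LIMSEQ_power_zero) simp
  ultimately have "prob ?Z \<le> 0" by (intro LIMSEQ_le_const[of "\<lambda>k. (1 / 2) ^ k :: real"]) blast+
  then have "emeasure fair_source ?Z = 0" by (simp add: emeasure_eq_measure measure_le_0_iff)
  with \<open>?Z \<in> events\<close> show ?thesis by (intro AE_I[of _ _ ?Z]) auto
qed

text \<open>Exchangeability: all coordinates are independent with the same law, so reindexing along
  an injection preserves the product measure.\<close>

lemma AE_fair_source_permute:
  assumes "bij \<gamma>" and [measurable]: "Measurable.pred fair_source P"
  shows "(AE x in fair_source. P (\<lambda>(i, n). x (\<gamma> i, n))) \<longleftrightarrow> (AE x in fair_source. P x)"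
proof -
  let ?f = "\<lambda>(i :: nat, n :: nat). (\<gamma> i, n)"
  have eq: "(\<lambda>x :: nat \<times> nat \<Rightarrow> nat. \<lambda>t\<in>UNIV. x (?f t)) = (\<lambda>x (i, n). x (\<gamma> i, n))"
    by (auto simp: fun_eq_iff)
  have "distr fair_source fair_source (\<lambda>x. \<lambda>t\<in>UNIV. x (?f t)) = fair_source"
    unfolding fair_source_def
    by (rule distr_PiM_reindex) (auto simp: inj_on_def inj_eq[OF bij_is_inj[OF assms(1)]] measure_pmf.prob_space_axioms)
  then have d: "distr fair_source fair_source (\<lambda>x (i, n). x (\<gamma> i, n)) = fair_source" unfolding eq .
  have "(\<lambda>x. \<lambda>t\<in>UNIV. x (?f t)) \<in> measurable fair_source (PiM UNIV (\<lambda>_. measure_pmf (geometric_pmf (1 / 2))))"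
    by (rule measurable_restrict) (simp cong: measurable_cong_sets)
  then have m: "(\<lambda>x (i, n). x (\<gamma> i, n)) \<in> measurable fair_source fair_source"
    unfolding fair_source_def[symmetric] eq .
  have "(AE x in distr fair_source fair_source (\<lambda>x (i, n). x (\<gamma> i, n)). P x) \<longleftrightarrow>
      (AE x in fair_source. P (\<lambda>(i, n). x (\<gamma> i, n)))"
    using AE_distr_iff[OF m, of P] assms(2) by (simp add: pred_def)
  then show ?thesis unfolding d by simp
qed

lemma full_support_pmf:
  assumes "countable S" "S \<noteq> {}"
  obtains p where "set_pmf p = S"
proof (rule that[of "map_pmf (from_nat_into S) (geometric_pmf (1 / 2))"])
  show "set_pmf (map_pmf (from_nat_into S) (geometric_pmf (1 / 2))) = S"
    using assms by (simp add: set_pmf_geometric)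
qed

section \<open>The law of the limit structure\<close>

context particle_structure
begin

lemma AE_good: "AE x in fair_source. good x"
proof -
  have "AE x in fair_source. \<forall>m. i \<noteq> j \<longrightarrow> (\<exists>n\<ge>m. x (i, Suc n) = 0 \<longleftrightarrow> x (j, Suc n) \<noteq> 0)" for i j
    using AE_fair_source_coins[of i j] by (cases "i = j") (simp_all add: AE_all_countable)
  then have "AE x in fair_source. \<forall>i j m. i \<noteq> j \<longrightarrow> (\<exists>n\<ge>m. x (i, Suc n) = 0 \<longleftrightarrow> x (j, Suc n) \<noteq> 0)"
    unfolding AE_all_countable by blast
  moreover have "AE x in fair_source. \<forall>a m. \<exists>i\<ge>m. x (i, 0) = a"
    unfolding AE_all_countable using AE_fair_source_start by blast
  ultimately show ?thesis
    by eventually_elim (simp add: good_def)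
qed

lemma measurable_val [measurable]: "(\<lambda>x. val \<phi> x n i) \<in> measurable fair_source (count_space UNIV)"
proof -
  have "(\<lambda>x. pos x n i) \<in> measurable fair_source (count_space UNIV)"
  proof (induction n)
    case (Suc n)
    note Suc [measurable]
    show ?case unfolding pos.simps by measurable
  qed simp
  then show ?thesis unfolding val_def by (cases "map_of (zip \<phi> fs) i") simp_all
qed

text \<open>\<open>Q\<close> may be arbitrary because there are only countably many lists of
  numbers.\<close>

lemma pred_map_val:
  "Measurable.pred fair_source (\<lambda>x. Q (map (val \<phi> x n) is))"
proof -
  have "Measurable.pred fair_source (\<lambda>x. map (val \<phi> x n) is = bs)" for bs
  proof -
    have "(\<lambda>x. map (val \<phi> x n) is = bs) = (\<lambda>x. length is = length bs \<and> (\<forall>k\<in>{..<length is}. val \<phi> x n (is ! k) = bs ! k))"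
      by (auto simp: list_eq_iff_nth_eq)
    also have "Measurable.pred fair_source \<dots>" by measurable
    finally show ?thesis .
  qed
  note this [measurable]
  have "(\<lambda>x. Q (map (val \<phi> x n) is)) = (\<lambda>x. \<exists>bs\<in>{bs. Q bs}. map (val \<phi> x n) is = bs)" by auto
  also have "Measurable.pred fair_source \<dots>" by measurable
  finally show ?thesis .
qed

lemma measurable_limit_structure:
  assumes "countable_language L"
  shows "limit_structure \<phi> \<in> measurable fair_source (Str_borel L)"
proof (rule measurable_Str_borel[OF assms])
  show "limit_structure \<phi> \<in> space fair_source \<rightarrow> Str L" using limit_structure_in_Str by blast
next
  fix R and "is" :: "nat list" assume R: "R \<in> rel_syms L" "length is = rel_arity L R"
  note pred_map_val [measurable]
  have "Measurable.pred fair_source (\<lambda>x. \<exists>n. \<forall>m\<in>{n..}. fst N R (map (val \<phi> x m) is))" by measurable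
  then show "{x \<in> space fair_source. fst (limit_structure \<phi> x) R is} \<in> sets fair_source"
    using R by (simp add: limit_structure_def tuples_def eventually_sequentially pred_def Ball_def)
next
  fix f b and "is" :: "nat list" assume f: "f \<in> fun_syms L" "length is = fun_arity L f"
  \<comment> \<open>Consing \<open>j\<close> onto the tuple turns the comparison with the position
    of \<open>j\<close> into a property of one list.\<close>
  have "Measurable.pred fair_source (\<lambda>x. snd N f (map (val \<phi> x m) is) = val \<phi> x m j)" for m j
    using pred_map_val[of "\<lambda>bs. snd N f (tl bs) = hd bs" \<phi> m "j # is"] by simp
  note this [measurable]
  have "Measurable.pred fair_source (\<lambda>x. \<exists>n. \<forall>m\<in>{n..}. snd N f (map (val \<phi> x m) is) = val \<phi> x m j)" for j
    by measurable
  then have "Measurable.pred fair_source (\<lambda>x. eventually (\<lambda>m. snd N f (map (val \<phi> x m) is) = val \<phi> x m j) sequentially)" for j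
    by (simp add: eventually_sequentially Ball_def)
  note this [measurable]
  have "(\<lambda>x. LEAST j. eventually (\<lambda>m. snd N f (map (val \<phi> x m) is) = val \<phi> x m j) sequentially) \<in>
      measurable fair_source (count_space UNIV)" by measurable
  then have "Measurable.pred fair_source (\<lambda>x. (LEAST j. eventually (\<lambda>m. snd N f (map (val \<phi> x m) is) = val \<phi> x m j) sequentially) = b)"
    by measurable
  then show "{x \<in> space fair_source. snd (limit_structure \<phi> x) f is = b} \<in> sets fair_source"
    using f by (simp add: limit_structure_def tuples_def pred_def)
qed

lemma placements_nonempty: "placements \<noteq> {}"
  unfolding placements_def by (auto intro!: exI[of _ fs] fs)

lemma map_placements:
  assumes "bij \<gamma>"
  shows "map \<gamma> ` placements = placements"
proof
  show "map \<gamma> ` placements \<subseteq> placements"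
    using inj_on_subset[OF bij_is_inj[OF assms]] by (auto simp: placements_def distinct_map)
  show "placements \<subseteq> map \<gamma> ` placements"
  proof
    fix \<phi> assume "\<phi> \<in> placements"
    then have "map (inv \<gamma>) \<phi> \<in> placements"
      using inj_on_subset[OF bij_is_inj[OF bij_imp_bij_inv[OF assms]]] by (auto simp: placements_def distinct_map)
    moreover have "map \<gamma> (map (inv \<gamma>) \<phi>) = \<phi>"
      using assms by (simp add: o_def bij_is_surj surj_f_inv_f)
    ultimately show "\<phi> \<in> map \<gamma> ` placements" by (metis imageI)
  qed
qed

text \<open>The measure mixes the laws \<open>K \<phi>\<close> with positive weight on every
  placement. A permutation sends the law of one placement to that of another, which may change the
  weights but not the null sets of the mixture.\<close>

theorem quasi_random_limit:
  assumes L: "countable_language L" and N: "N \<in> Str L"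
  shows "quasi_random L N"
proof -
  interpret source: prob_space fair_source by (rule prob_space_fair_source)
  obtain p where p: "set_pmf p = placements"
    by (rule full_support_pmf[OF countableI_type placements_nonempty])
  define K where "K \<phi> = distr fair_source (Str_borel L) (limit_structure \<phi>)" for \<phi>
  define \<mu> where "\<mu> = measure_pmf p \<bind> K"
  note m = measurable_limit_structure[OF L]
  have probK: "prob_space (K \<phi>)" for \<phi> unfolding K_def by (rule source.prob_space_distr[OF m])
  have K: "K \<in> measurable (measure_pmf p) (subprob_algebra (Str_borel L))"
    using probK by (auto simp: space_subprob_algebra K_def intro: prob_space_imp_subprob_space)
  have sets: "sets \<mu> = sets (Str_borel L)"
    unfolding \<mu>_def by (rule sets_bind) (simp_all add: K_def)
  interpret prob_space \<mu>
    unfolding \<mu>_def by (rule measure_pmf.prob_space_bind[OF _ K]) (simp add: probK)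
  \<comment> \<open>Full support of \<open>p\<close> on \<open>placements\<close> makes a set null
    for the mixture exactly if it is null for every placement.\<close>
  have null_iff: "emeasure \<mu> B = 0 \<longleftrightarrow> (\<forall>\<phi>\<in>placements. AE x in fair_source. limit_structure \<phi> x \<notin> B)"
    if B: "B \<in> sets (Str_borel L)" for B
  proof -
    have "emeasure \<mu> B = (\<integral>\<^sup>+\<phi>. emeasure (K \<phi>) B \<partial>measure_pmf p)"
      unfolding \<mu>_def by (rule emeasure_bind[OF _ K B]) simp
    then have "emeasure \<mu> B = 0 \<longleftrightarrow> (\<forall>\<phi>\<in>placements. emeasure (K \<phi>) B = 0)"
      using p by (simp add: nn_integral_0_iff_AE AE_measure_pmf_iff)
    moreover have "emeasure (K \<phi>) B = 0 \<longleftrightarrow> (AE x in fair_source. limit_structure \<phi> x \<notin> B)" for \<phi>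
    proof -
      have "{x. limit_structure \<phi> x \<in> B} \<in> sets fair_source"
        using measurable_sets[OF m B, of \<phi>] by (simp add: vimage_def)
      then show ?thesis
        unfolding K_def using B by (simp add: emeasure_distr[OF m B] vimage_def AE_iff_measurable[OF _ refl])
    qed
    ultimately show ?thesis by simp
  qed
  have "emeasure \<mu> (space \<mu> - iso_class L N) = 0"
  proof -
    have "iso_class L N \<in> sets (Str_borel L)" using tp_set_Borel[OF L N, of "[]" "[]"] by (simp add: tp_set_Nil)
    then have "space \<mu> - iso_class L N \<in> sets (Str_borel L)" using sets by (metis sets.Diff sets.top)
    moreover have "AE x in fair_source. limit_structure \<phi> x \<notin> space \<mu> - iso_class L N" if "\<phi> \<in> placements" for \<phi>
      using AE_good by eventually_elim (use limit_structure_iso[OF that] in blast)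
    ultimately show ?thesis using null_iff by blast
  qed
  moreover have "iso_class L N \<in> events"
    unfolding sets using tp_set_Borel[OF L N, of "[]" "[]"] by (simp add: tp_set_Nil)
  ultimately have iso: "emeasure \<mu> (iso_class L N) = 1"
    using prob_compl[of "iso_class L N"] by (simp add: emeasure_eq_measure)
  have "quasi_invariant L \<mu>"
    unfolding quasi_invariant_def
  proof (intro ballI allI impI)
    fix B and g :: "nat \<Rightarrow> nat" assume B: "B \<in> sets (Str_borel L)" and g: "bij g"
    let ?g = "inv g"
    have g': "bij ?g" "inv ?g = g" using g by (auto simp: bij_imp_bij_inv inv_inv_eq)
    have BS: "B \<subseteq> Str L" using sets.sets_into_space[OF B] by (simp add: space_Str_borel)
    have im: "logic_action L g ` B = logic_action L ?g -` B \<inter> Str L" by (rule logic_action_image[OF g BS])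
    then have gB: "logic_action L g ` B \<in> sets (Str_borel L)"
      using measurable_sets[OF measurable_logic_action[OF L g'(1)] B] by (simp add: space_Str_borel)
    \<comment> \<open>Equivariance trades \<open>g\<close> for relabelled placement and sample;
      exchangeability then removes the relabelling of the sample, and only that of the placement
      remains.\<close>
    have "(AE x in fair_source. limit_structure \<phi> x \<notin> logic_action L g ` B) \<longleftrightarrow>
        (AE x in fair_source. limit_structure (map ?g \<phi>) x \<notin> B)" if \<phi>: "\<phi> \<in> placements" for \<phi>
    proof -
      have "(AE x in fair_source. limit_structure \<phi> x \<notin> logic_action L g ` B) \<longleftrightarrow>
          (AE x in fair_source. limit_structure (map ?g \<phi>) (\<lambda>(i, n). x (g i, n)) \<notin> B)"
      proof (rule eventually_subst)
        show "AE x in fair_source. limit_structure \<phi> x \<notin> logic_action L g ` B \<longleftrightarrow>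
           limit_structure (map ?g \<phi>) (\<lambda>(i, n). x (g i, n)) \<notin> B"
          using AE_good
        proof eventually_elim
          case (elim x)
          then show ?case
            using limit_structure_permute[OF \<phi> _ g'(1), of x] limit_structure_in_Str unfolding im g'(2) by simp
        qed
      qed
      also have "\<dots> \<longleftrightarrow> (AE x in fair_source. limit_structure (map ?g \<phi>) x \<notin> B)"
      proof (rule AE_fair_source_permute[OF g, of "\<lambda>x. limit_structure (map ?g \<phi>) x \<notin> B"])
        have "limit_structure (map ?g \<phi>) -` (space (Str_borel L) - B) \<inter> space fair_source \<in> sets fair_source"
          by (rule measurable_sets[OF m]) (use B in auto)
        moreover have "limit_structure (map ?g \<phi>) -` (space (Str_borel L) - B) \<inter> space fair_source =
            {x \<in> space fair_source. limit_structure (map ?g \<phi>) x \<notin> B}"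
          using limit_structure_in_Str by (auto simp: space_Str_borel)
        ultimately show "Measurable.pred fair_source (\<lambda>x. limit_structure (map ?g \<phi>) x \<notin> B)"
          by (simp add: pred_def)
      qed
      finally show ?thesis .
    qed
    then have "emeasure \<mu> (logic_action L g ` B) = 0 \<longleftrightarrow>
        (\<forall>\<phi>\<in>map ?g ` placements. AE x in fair_source. limit_structure \<phi> x \<notin> B)"
      unfolding null_iff[OF gB] by simp
    then show "emeasure \<mu> B = 0 \<longleftrightarrow> emeasure \<mu> (logic_action L g ` B) = 0"
      unfolding null_iff[OF B] map_placements[OF g'(1)] by simp
  qed
  moreover have "borel_prob_measure L \<mu>"
    unfolding borel_prob_measure_def using sets prob_space_axioms by simp
  ultimately show ?thesis using iso unfolding quasi_random_def by blast
qed

end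

section \<open>Building the particle system from a bound on algebraic closures\<close>

theorem quasi_random_if_not_highly_algebraic:
  assumes L: "countable_language L" and N: "N \<in> Str L" and alg: "\<not> highly_algebraic L N"
  shows "quasi_random L N"
proof -
  obtain F where F: "finite F" "\<And>as. acl L as N \<subseteq> F \<union> set as"
    using alg by (auto simp: highly_algebraic_def)
  define fs where "fs = sorted_list_of_set F"
  have fs: "set fs = F" "distinct fs" using F(1) by (auto simp: fs_def)
  define G where "G = Aut_stabilizer L N fs"
  have G_iff: "g \<in> G \<longleftrightarrow> isomorphism L N N g \<and> (\<forall>a\<in>F. g a = a)" for g
    by (simp add: G_def Aut_stabilizer_def Aut_def fs(1))
  have bijG: "bij g" if "g \<in> G" for g using that by (simp add: G_iff isomorphism_def)
  interpret infinite_orbits G F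
  proof
    show "finite F" by fact
    show "id \<in> G" by (simp add: G_iff isomorphism_id)
    show "g \<circ> h \<in> G" if "g \<in> G" "h \<in> G" for g h
      using that isomorphism_comp[of L N N h N g] unfolding G_iff by simp
    show "inv g \<in> G" if "g \<in> G" for g
    proof -
      have "inv g a = a" if "g a = a" for a using bijG[OF \<open>g \<in> G\<close>] that by (metis bij_is_inj inv_f_f)
      then show ?thesis using that isomorphism_inv[of L N N g] unfolding G_iff by simp
    qed
    show "bij g" if "g \<in> G" for g using bijG that .
    show "g a = a" if "g \<in> G" "a \<in> F" for g a using that by (simp add: G_iff)
    show "infinite {g b | g. g \<in> G \<and> (\<forall>a\<in>B. g a = a)}" if "finite B" "b \<notin> F \<union> B" for B b
    proof -
      obtain bs where bs: "set bs = B" using finite_list[OF \<open>finite B\<close>] by blast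
      \<comment> \<open>Non-algebraicity over \<open>fs @ bs\<close> is an infinite orbit under the
        automorphisms fixing \<open>F\<close> and \<open>B\<close>, which form the stabilizer of
        \<open>B\<close> in \<open>G\<close>.\<close>
      have "b \<notin> acl L (fs @ bs) N" using F(2)[of "fs @ bs"] that fs bs by auto
      moreover have "g \<in> Aut_stabilizer L N (fs @ bs) \<longleftrightarrow> g \<in> G \<and> (\<forall>a\<in>B. g a = a)" for g
        by (auto simp: G_iff Aut_stabilizer_def Aut_def fs(1) bs)
      ultimately show ?thesis by (simp add: acl_def)
    qed
  qed
  \<comment> \<open>The first component of the decoded pair codes the demand; the second is ignored
    and makes every demand recur.\<close>
  define task :: "nat \<Rightarrow> nat list \<times> nat" where "task n = from_nat (fst (prod_decode n))" for n
  obtain A d where Ad: "\<And>n. finite (A n)" "\<And>n. A n \<inter> F = {}" "\<And>n. A n \<subseteq> A (Suc n)" "\<And>n. n \<notin> F \<Longrightarrow> n \<in> A (Suc n)"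
    "\<And>n. d n ` A n \<subseteq> A (Suc n)" "\<And>n. inj_on (d n) (A n)" "\<And>n. d n ` A n \<inter> A n = {}"
    "\<And>n c. \<exists>g\<in>G. \<forall>a\<in>A n. g a = (if c a then d n a else a)"
    "\<And>n as c g. task n = (as, c) \<Longrightarrow> c \<notin> F \<union> set as \<Longrightarrow> g \<in> G \<Longrightarrow> set (map g as) \<subseteq> A n \<union> d n ` A n \<union> F \<Longrightarrow>
       \<exists>g'\<in>G. map g' as = map g as \<and> g' c \<in> A (Suc n) - A n"
    by (rule exhaustion[of task], rule that)
  have recurs: "\<exists>n\<ge>m. task n = (as, c)" for m as c
    by (rule exI[of _ "prod_encode (to_nat (as, c), m)"]) (simp add: task_def le_prod_encode_2)
  obtain c0 where c0: "c0 \<notin> F" using F(1) ex_new_if_finite infinite_UNIV_nat by blast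
  interpret particle_structure G F A d task fs c0 L N
    by unfold_locales (use Ad recurs fs c0 in \<open>simp_all add: G_def Aut_stabilizer_def\<close>)
  show ?thesis by (rule quasi_random_limit[OF L N])
qed

theorem theorem1p2:
  fixes L :: "('r, 'f) language" and N :: "('r, 'f) struct"
  assumes "countable_language L" and "N \<in> Str L"
  shows "quasi_random L N \<longleftrightarrow> \<not> highly_algebraic L N"
  using not_quasi_random_if_highly_algebraic[OF assms] quasi_random_if_not_highly_algebraic[OF assms]
  by blast

end
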